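(* The class of triangle-free unit-square graphs is $(6,1)$-disjointness-expressing.
   Context: A unit-square graph is the graph associated to a finite set $P$ of points in the plane, with vertex set $P$ and two points adjacent iff their $\ell_\infty$-distance is at most 1 (equivalently, an intersection graph of axis-parallel unit squares). A class $\mathcal{C}$ of graphs is $(s,\kappa)$-disjointness-expressing if for some constant $\alpha>0$, for every positive integer $N$ and every $X\subseteq\{1,\dots,N\}$ one can define graphs $L(X)$ and $R(X)$, each containing a labelled set $S$ of special vertices, such that for all $A,B\subseteq\{1,\dots,N\}$: (i) the graph $g(L(A),R(B))$ obtained by identifying each vertex of $S$ in $L(A)$ with the corresponding vertex of $S$ in $R(B)$ is connected and has at most $\alpha N^{1/\kappa}$ vertices; (ii) the subgraph of $g(L(A),R(B))$ induced by the closed neighborhood $N[S]$ is independent of $A,B$ (for all $A,A',B,B'$ there is an isomorphism between these induced subgraphs that is the identity on $S$) and has at most $s$ vertices; (iii) $g(L(A),R(B))\in\mathcal{C}$ if and only if $A\cap B=\emptyset$. *)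

theory Defs
  imports Complex_Main
begin

text \<open>A (finite, simple) graph is given by a vertex set V and an adjacency relation E.\<close>
definition simple_graph :: "'v set \<Rightarrow> ('v \<Rightarrow> 'v \<Rightarrow> bool) \<Rightarrow> bool" where
  "simple_graph V E \<longleftrightarrow> finite V \<and> (\<forall>u v. E u v \<longrightarrow> u \<in> V \<and> v \<in> V)
     \<and> (\<forall>u v. E u v \<longrightarrow> E v u) \<and> (\<forall>v. \<not> E v v)"

definition graph_connected :: "'v set \<Rightarrow> ('v \<Rightarrow> 'v \<Rightarrow> bool) \<Rightarrow> bool" where
  "graph_connected V E \<longleftrightarrow>
     (\<forall>u\<in>V. \<forall>v\<in>V. (u, v) \<in> {(x, y). x \<in> V \<and> y \<in> V \<and> E x y}\<^sup>*)"

text \<open>l-infinity distance in the plane\<close>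
definition linf_dist :: "real \<times> real \<Rightarrow> real \<times> real \<Rightarrow> real" where
  "linf_dist p q = max \<bar>fst p - fst q\<bar> \<bar>snd p - snd q\<bar>"

text \<open>Unit-square graph: isomorphic to the graph on a finite point set P, points adjacent
  iff their l-infinity distance is at most 1.\<close>
definition unit_square_graph :: "'v set \<Rightarrow> ('v \<Rightarrow> 'v \<Rightarrow> bool) \<Rightarrow> bool" where
  "unit_square_graph V E \<longleftrightarrow> (\<exists>p :: 'v \<Rightarrow> real \<times> real. inj_on p V \<and>
     (\<forall>u\<in>V. \<forall>v\<in>V. u \<noteq> v \<longrightarrow> (E u v \<longleftrightarrow> linf_dist (p u) (p v) \<le> 1)))"

definition triangle_free :: "'v set \<Rightarrow> ('v \<Rightarrow> 'v \<Rightarrow> bool) \<Rightarrow> bool" where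
  "triangle_free V E \<longleftrightarrow> \<not> (\<exists>u\<in>V. \<exists>v\<in>V. \<exists>w\<in>V. u \<noteq> v \<and> v \<noteq> w \<and> u \<noteq> w
      \<and> E u v \<and> E v w \<and> E u w)"

definition triangle_free_unit_square :: "'v set \<Rightarrow> ('v \<Rightarrow> 'v \<Rightarrow> bool) \<Rightarrow> bool" where
  "triangle_free_unit_square V E \<longleftrightarrow> simple_graph V E \<and> triangle_free V E \<and> unit_square_graph V E"

text \<open>Closed neighbourhood of a vertex set S.\<close>
definition closed_nbhd :: "'v set \<Rightarrow> ('v \<Rightarrow> 'v \<Rightarrow> bool) \<Rightarrow> 'v set \<Rightarrow> 'v set" where
  "closed_nbhd V E S = S \<union> {v \<in> V. \<exists>u\<in>S. E u v}"

text \<open>Gluing: L(A) = (VL A, EL A) and R(B) = (VR B, ER B) share exactly the special set S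
  (this sharing realises the identification of corresponding special vertices);
  the glued graph is the union.\<close>
definition glue_V :: "'v set \<Rightarrow> 'v set \<Rightarrow> 'v set" where
  "glue_V VL VR = VL \<union> VR"

definition glue_E :: "('v \<Rightarrow> 'v \<Rightarrow> bool) \<Rightarrow> ('v \<Rightarrow> 'v \<Rightarrow> bool) \<Rightarrow> 'v \<Rightarrow> 'v \<Rightarrow> bool" where
  "glue_E EL ER u v \<longleftrightarrow> EL u v \<or> ER u v"

definition disjointness_expressing ::
  "('v set \<Rightarrow> ('v \<Rightarrow> 'v \<Rightarrow> bool) \<Rightarrow> bool) \<Rightarrow> nat \<Rightarrow> real \<Rightarrow> bool" where
  "disjointness_expressing C s \<kappa> \<longleftrightarrow>
    (\<exists>\<alpha>::real. \<alpha> > 0 \<and> (\<forall>N::nat. N > 0 \<longrightarrow>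
      (\<exists>(S :: 'v set) (VL :: nat set \<Rightarrow> 'v set) EL (VR :: nat set \<Rightarrow> 'v set) ER.
         (\<forall>X \<subseteq> {1..N}. simple_graph (VL X) (EL X) \<and> simple_graph (VR X) (ER X)
              \<and> S \<subseteq> VL X \<and> S \<subseteq> VR X) \<and>
         (\<forall>A \<subseteq> {1..N}. \<forall>B \<subseteq> {1..N}.
              VL A \<inter> VR B = S
            \<and> graph_connected (glue_V (VL A) (VR B)) (glue_E (EL A) (ER B))
            \<and> real (card (glue_V (VL A) (VR B))) \<le> \<alpha> * real N powr (1 / \<kappa>)
            \<and> card (closed_nbhd (glue_V (VL A) (VR B)) (glue_E (EL A) (ER B)) S) \<le> s
            \<and> (C (glue_V (VL A) (VR B)) (glue_E (EL A) (ER B)) \<longleftrightarrow> A \<inter> B = {})) \<and>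
         (\<forall>A \<subseteq> {1..N}. \<forall>B \<subseteq> {1..N}. \<forall>A' \<subseteq> {1..N}. \<forall>B' \<subseteq> {1..N}.
            (let V = glue_V (VL A) (VR B); E = glue_E (EL A) (ER B);
                 V' = glue_V (VL A') (VR B'); E' = glue_E (EL A') (ER B');
                 M = closed_nbhd V E S; M' = closed_nbhd V' E' S
             in \<exists>f. bij_betw f M M' \<and> (\<forall>x\<in>S. f x = x) \<and>
                   (\<forall>u\<in>M. \<forall>v\<in>M. E u v \<longleftrightarrow> E' (f u) (f v)))))))"

end

theory Submission
  imports Defs "HOL-Library.Countable"
begin

text \<open>
In a triangle-free drawing a vertex has at most one neighbour per quadrant, so four-cycles that share
opposite vertices form a rigid chain: a horizontal chain advances by more than 1 to the right
per step while its height changes by less than 1, and a vertical chain behaves symmetrically. A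
horizontal chain and a vertical chain with common ends are therefore both forced to follow the
diagonal. In $L$ these two chains bound a corridor, and $R$ is a path through the corridor that is
so short that its $k$-th vertex has to lie next to the $k$-th vertices of both chains.
Pairs of pendant vertices encode the bits: each of the pairs of $L$ and of $R$ pushes
a vertex into one of a sequence of boxes of side less than 1, which hold at most one vertex each.
Each set alone leaves enough free boxes; a common element of both sets puts five vertices into four boxes.
\<close>

section \<open>The graphs\<close>

text \<open>Rigidity is a race between speeds. In the first coordinate one step of the horizontal
  chain gains more than 1, while one step of the vertical chain or of the path gains at most 1; in
  the second coordinate the vertical chain is the fast one. Hence an inequality known at one end of
  the corridor spreads over all levels: lags at the near end, where chains and path leave from
  \<open>Ht 0\<close>, persist forward, and the bounds which \<open>Cx\<close> and \<open>Cy\<close>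
  impose at the far end persist backward. This is how a corridor of any length can be controlled
  although only two vertices are shared. The same race is the obstacle for the converse: a drawing
  must gain strictly at each step, but may gain so little that the total stays small against all
  other distances.\<close>

text \<open>
\<^item> Horizontal chain: nodes \<open>Hu\<close>, the vertices \<open>Ht j\<close> (top) and \<open>Hd j\<close> (bottom) between \<open>Hu (j - 1)\<close> and \<open>Hu j\<close>,
  and \<open>Hf j\<close>, which keeps \<open>Hd j\<close> and \<open>Hd (j + 1)\<close> on the same side; \<open>He\<close> and \<open>Hw\<close> are the pendants of \<open>Ht\<close>.
\<^item> Vertical chain: nodes \<open>Vu\<close>, right and left vertices \<open>Vr\<close> and \<open>Vl\<close>, and \<open>Vf\<close> in the role of \<open>Hf\<close>.
  Both chains start in a ladder with \<open>Cw\<close>, where \<open>Ht 0\<close> also plays the role of \<open>Vr 0\<close>.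
\<^item> Path: \<open>Ru 2\<close>, \<dots>, \<open>Ru (n + 1)\<close> with pendants \<open>Rn\<close> and \<open>Rs\<close>; its ends are the special vertices.
\<^item> \<open>Cx\<close> and \<open>Cy\<close> close the corridor at the far end.
\<close>
datatype vtx = Hu nat | Ht nat | Hd nat | Hf nat | He nat | Hw nat
  | Vu nat | Vr nat | Vl nat | Vf nat | Ru nat | Rn nat | Rs nat | Cw | Cx | Cy

primrec arc :: "nat \<Rightarrow> vtx \<Rightarrow> vtx \<Rightarrow> bool" where
  "arc n (Hu i) v = (case v of Ht j \<Rightarrow> j = i \<or> j = Suc i | Hd j \<Rightarrow> j = i \<or> j = Suc i | _ \<Rightarrow> False)"
| "arc n (Ht i) v = (case v of He j \<Rightarrow> j = i | Hw j \<Rightarrow> j = i | Vu j \<Rightarrow> i = 0 \<and> j = 0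
     | Ru j \<Rightarrow> i = 0 \<and> j = 2 | Cw \<Rightarrow> i = 0 | Cx \<Rightarrow> i = n + 1 \<or> i = n + 2 | _ \<Rightarrow> False)"
| "arc n (Hd i) v = (case v of Hf j \<Rightarrow> i = j \<or> i = Suc j | Cw \<Rightarrow> i = 0 | _ \<Rightarrow> False)"
| "arc n (Hf i) v = False"
| "arc n (He i) v = False"
| "arc n (Hw i) v = False"
| "arc n (Vu i) v = (case v of Vr j \<Rightarrow> j = i \<or> j = Suc i | Vl j \<Rightarrow> j = i \<or> j = Suc i | _ \<Rightarrow> False)"
| "arc n (Vr i) v = (case v of Cy \<Rightarrow> i = n + 1 | _ \<Rightarrow> False)"
| "arc n (Vl i) v = (case v of Vf j \<Rightarrow> i = j \<or> i = Suc j | Cw \<Rightarrow> i = 0 | _ \<Rightarrow> False)"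
| "arc n (Vf i) v = False"
| "arc n (Ru i) v = (case v of Ru j \<Rightarrow> j = Suc i | Rn j \<Rightarrow> j = i | Rs j \<Rightarrow> j = i | Cy \<Rightarrow> i = n + 1 | _ \<Rightarrow> False)"
| "arc n (Rn i) v = False"
| "arc n (Rs i) v = False"
| "arc n Cw v = False"
| "arc n Cx v = (v = Cy)"
| "arc n Cy v = False"

primrec inL :: "nat \<Rightarrow> (nat \<Rightarrow> bool) \<Rightarrow> vtx \<Rightarrow> bool" where
  "inL n P (Hu j) \<longleftrightarrow> j \<le> n + 2"
| "inL n P (Ht j) \<longleftrightarrow> j \<le> n + 2"
| "inL n P (Hd j) \<longleftrightarrow> j \<le> n + 2"
| "inL n P (Hf j) \<longleftrightarrow> j \<le> n + 1"
| "inL n P (He j) \<longleftrightarrow> P j"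
| "inL n P (Hw j) \<longleftrightarrow> P j"
| "inL n P (Vu j) \<longleftrightarrow> j \<le> n + 1"
| "inL n P (Vr j) \<longleftrightarrow> 1 \<le> j \<and> j \<le> n + 1"
| "inL n P (Vl j) \<longleftrightarrow> j \<le> n + 1"
| "inL n P (Vf j) \<longleftrightarrow> j \<le> n"
| "inL n P (Ru j) \<longleftrightarrow> j = 2 \<or> j = n + 1"
| "inL n P (Rn j) \<longleftrightarrow> False"
| "inL n P (Rs j) \<longleftrightarrow> False"
| "inL n P Cw \<longleftrightarrow> True"
| "inL n P Cx \<longleftrightarrow> True"
| "inL n P Cy \<longleftrightarrow> True"

primrec inR :: "nat \<Rightarrow> (nat \<Rightarrow> bool) \<Rightarrow> vtx \<Rightarrow> bool" where
  "inR n P (Ru j) \<longleftrightarrow> 2 \<le> j \<and> j \<le> n + 1"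
| "inR n P (Rn j) \<longleftrightarrow> P j"
| "inR n P (Rs j) \<longleftrightarrow> P j"
| "inR n P (Hu j) \<longleftrightarrow> False"
| "inR n P (Ht j) \<longleftrightarrow> False"
| "inR n P (Hd j) \<longleftrightarrow> False"
| "inR n P (Hf j) \<longleftrightarrow> False"
| "inR n P (He j) \<longleftrightarrow> False"
| "inR n P (Hw j) \<longleftrightarrow> False"
| "inR n P (Vu j) \<longleftrightarrow> False"
| "inR n P (Vr j) \<longleftrightarrow> False"
| "inR n P (Vl j) \<longleftrightarrow> False"
| "inR n P (Vf j) \<longleftrightarrow> False"
| "inR n P Cw \<longleftrightarrow> False"
| "inR n P Cx \<longleftrightarrow> False"
| "inR n P Cy \<longleftrightarrow> False"

definition link :: "nat \<Rightarrow> vtx \<Rightarrow> vtx \<Rightarrow> bool" where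
  "link n u v \<longleftrightarrow> arc n u v \<or> arc n v u"

definition EL :: "nat \<Rightarrow> (nat \<Rightarrow> bool) \<Rightarrow> vtx \<Rightarrow> vtx \<Rightarrow> bool" where
  "EL n P u v \<longleftrightarrow> inL n P u \<and> inL n P v \<and> link n u v"

definition ER :: "nat \<Rightarrow> (nat \<Rightarrow> bool) \<Rightarrow> vtx \<Rightarrow> vtx \<Rightarrow> bool" where
  "ER n P u v \<longleftrightarrow> inR n P u \<and> inR n P v \<and> link n u v"

definition inV :: "nat \<Rightarrow> (nat \<Rightarrow> bool) \<Rightarrow> (nat \<Rightarrow> bool) \<Rightarrow> vtx \<Rightarrow> bool" where
  "inV n P Q v \<longleftrightarrow> inL n P v \<or> inR n Q v"

text \<open>No arc joins the interior of one side to the interior of the other. Hence the glued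
  graph is the subgraph of \<open>link\<close> induced on its vertices, and all later arguments work
  with \<open>link\<close>.\<close>

lemma arc_inR: "1 \<le> n \<Longrightarrow> arc n u v \<Longrightarrow> inR n Q u \<Longrightarrow> inL n P v \<Longrightarrow> inR n Q v \<or> inL n P u"
  by (cases u; cases v) auto

lemma arc_inL: "1 \<le> n \<Longrightarrow> arc n u v \<Longrightarrow> inL n P u \<Longrightarrow> inR n Q v \<Longrightarrow> inR n Q u \<or> inL n P v"
  by (cases u; cases v) auto

lemma glue_E_iff:
  assumes "1 \<le> n"
  shows "glue_E (EL n P) (ER n Q) u v \<longleftrightarrow>
     (inL n P u \<or> inR n Q u) \<and> (inL n P v \<or> inR n Q v) \<and> link n u v"
  unfolding glue_E_def EL_def ER_def link_def
  using arc_inR[OF assms, of u v Q P] arc_inR[OF assms, of v u Q P] arc_inL[OF assms, of u v P Q] arc_inL[OF assms, of v u P Q] by blast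

lemma triangle: "arc n u v \<Longrightarrow> arc n v w \<Longrightarrow> \<not> arc n u w \<and> \<not> arc n w u"
  by (cases u; cases v; cases w) auto

section \<open>Chains of four-cycles\<close>

definition near :: "('a \<Rightarrow> real) \<Rightarrow> ('a \<Rightarrow> real) \<Rightarrow> 'a \<Rightarrow> 'a \<Rightarrow> bool" where
  "near x y u v \<longleftrightarrow> x u \<le> x v + 1 \<and> x v \<le> x u + 1 \<and> y u \<le> y v + 1 \<and> y v \<le> y u + 1"

text \<open>The neighbours \<open>p\<close> and \<open>q\<close> occupy both left quadrants of \<open>c\<close>.\<close>
lemma right_of:
  assumes "near x y c p" "near x y c q" "near x y c s" "\<not> near x y p s" "\<not> near x y q s"
    "x p < x c" "x q < x c" "y q + 1 < y p"
  shows "x c < x s"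
  using assms unfolding near_def by linarith

text \<open>Both \<open>t\<close> and \<open>d\<close> lie to the right of \<open>c\<close> and are
  not adjacent, so their heights differ by more than 1; \<open>c'\<close> is adjacent to both, which
  leaves only the horizontal direction to separate it from \<open>c\<close>. So far \<open>t\<close>
  and \<open>d\<close> could still trade places; \<open>f\<close> is there to prevent this.\<close>

lemma chain_step:
  assumes "near x y c p" "near x y c q" "near x y c t" "near x y c d"
    "near x y t c'" "near x y d c'" "near x y q f" "near x y d f"
    "\<not> near x y p t" "\<not> near x y p d" "\<not> near x y q t" "\<not> near x y q d"
    "\<not> near x y t d" "\<not> near x y c c'" "\<not> near x y c f"
    "x p < x c" "x q < x c" "y q + 1 < y p"
  shows "x c < x t \<and> x c < x d \<and> y d + 1 < y t \<and> x c + 1 < x c' \<and> x t < x c' \<and> x d < x c'"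
proof -
  have t: "x c < x t" using assms by (intro right_of[of x y c p q t])
  have d: "x c < x d" using assms by (intro right_of[of x y c p q d])
  have td: "y t + 1 < y d \<or> y d + 1 < y t"
    using assms(3,4,13) t d unfolding near_def by linarith
  have c': "x c + 1 < x c'"
    using assms(3-6,14) t td unfolding near_def by linarith
  have x: "x t < x c'" "x d < x c'"
    using assms(3,4) c' unfolding near_def by linarith+
  have "y d + 1 < y t"
  proof (rule ccontr)
    assume "\<not> y d + 1 < y t"
    then have *: "y t + 1 < y d" using td by linarith
    \<comment> \<open>Now \<open>q\<close> is to the lower left and \<open>d\<close> to the upper
      right of \<open>c\<close>, so a common neighbour \<open>f\<close> of \<open>q\<close> and
      \<open>d\<close> is within 1 of \<open>c\<close> in both coordinates.\<close>
    have "y q < y c" "y c < y d" using * assms(1-4,18) unfolding near_def by linarith+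
    moreover have "y q \<le> y f + 1" "y d \<le> y f + 1" "x d \<le> x f + 1" "x f \<le> x q + 1" "y f \<le> y q + 1" "y f \<le> y d + 1"
      using assms(7,8) unfolding near_def by linarith+
    moreover have "x c - 1 < x f" "x f < x c + 1" using calculation assms(17) d by linarith+
    ultimately show False
      using assms(2,4,12,15,17) d unfolding near_def by linarith
  qed
  with c' x t d show ?thesis by blast
qed

lemma chain:
  assumes near: "\<And>j. j < m \<Longrightarrow> near x y (c j) (t j) \<and> near x y (c j) (d j) \<and> near x y (c j) (t (Suc j)) \<and>
      near x y (c j) (d (Suc j)) \<and> near x y (t (Suc j)) (c (Suc j)) \<and> near x y (d (Suc j)) (c (Suc j)) \<and>
      near x y (d j) (f j) \<and> near x y (d (Suc j)) (f j)"
    and far: "\<And>j. j < m \<Longrightarrow> \<not> near x y (t j) (t (Suc j)) \<and> \<not> near x y (t j) (d (Suc j)) \<and>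
      \<not> near x y (d j) (t (Suc j)) \<and> \<not> near x y (d j) (d (Suc j)) \<and> \<not> near x y (t (Suc j)) (d (Suc j)) \<and>
      \<not> near x y (c j) (c (Suc j)) \<and> \<not> near x y (c j) (f j)"
    and start: "x (t 0) < x (c 0)" "x (d 0) < x (c 0)" "y (d 0) + 1 < y (t 0)"
    and j: "j < m"
  shows "x (c j) + 1 < x (c (Suc j))" "x (t j) + 1 < x (t (Suc j))"
    "\<bar>y (c (Suc j)) - y (c j)\<bar> < 1" "y (t (Suc j)) \<le> y (c j) + 1"
    "y (c j) < y (t j)" "y (c j) < y (t (Suc j))" "y (c (Suc j)) < y (t (Suc j))"
    "x (t j) < x (c j)" "x (c j) < x (t (Suc j))" "x (t (Suc j)) < x (c (Suc j))"
proof -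
  have step: "x (c i) < x (t (Suc i)) \<and> x (c i) < x (d (Suc i)) \<and> y (d (Suc i)) + 1 < y (t (Suc i)) \<and>
      x (c i) + 1 < x (c (Suc i)) \<and> x (t (Suc i)) < x (c (Suc i)) \<and> x (d (Suc i)) < x (c (Suc i))"
    if "i < m" "x (t i) < x (c i)" "x (d i) < x (c i)" "y (d i) + 1 < y (t i)" for i
    using near[OF that(1)] far[OF that(1)] that(2-)
    by (intro chain_step[of x y "c i" "t i" "d i" _ _ _ "f i"]) auto
  have inv: "i \<le> m \<Longrightarrow> x (t i) < x (c i) \<and> x (d i) < x (c i) \<and> y (d i) + 1 < y (t i)" for i
  proof (induction i)
    case (Suc i)
    then show ?case using step[of i] by simp
  qed (use start in simp)
  have s: "x (c j) < x (t (Suc j))" "x (c j) < x (d (Suc j))" "y (d (Suc j)) + 1 < y (t (Suc j))"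
      "x (c j) + 1 < x (c (Suc j))" "x (t (Suc j)) < x (c (Suc j))" "x (d (Suc j)) < x (c (Suc j))"
      "x (t j) < x (c j)" "x (d j) < x (c j)" "y (d j) + 1 < y (t j)"
    using step[OF j] inv[of j] j by auto
  then show "x (c j) + 1 < x (c (Suc j))" "x (t j) < x (c j)" "x (c j) < x (t (Suc j))"
    "x (t (Suc j)) < x (c (Suc j))" by blast+
  have n: "near x y (c j) (t j)" "near x y (c j) (d j)" "near x y (c j) (t (Suc j))" "near x y (c j) (d (Suc j))"
    "near x y (t (Suc j)) (c (Suc j))" "near x y (d (Suc j)) (c (Suc j))" and f: "\<not> near x y (t j) (t (Suc j))"
    using near[OF j] far[OF j] by auto
  show "x (t j) + 1 < x (t (Suc j))" using s n(1-4) f unfolding near_def by linarith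
  show "\<bar>y (c (Suc j)) - y (c j)\<bar> < 1" "y (t (Suc j)) \<le> y (c j) + 1"
    "y (c j) < y (t j)" "y (c j) < y (t (Suc j))" "y (c (Suc j)) < y (t (Suc j))"
    using s n unfolding near_def by linarith+
qed

lemma increments:
  fixes g :: "nat \<Rightarrow> real"
  assumes "\<And>j. j < m \<Longrightarrow> g j + a \<le> g (Suc j)" "i \<le> j" "j \<le> m"
  shows "g i + a * (real j - real i) \<le> g j"
  using assms(2,3)
proof (induction j rule: dec_induct)
  case (step k)
  then show ?case using assms(1)[of k] by (simp add: algebra_simps)
qed simp

section \<open>Intersecting sets give no drawing\<close>

lemma link_irrefl: "\<not> link n u u"
  by (cases u) (auto simp: link_def)

text \<open>The assumption \<open>start\<close> loses no generality: exchanging and reflecting the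
  axes brings any drawing of the initial four-cycle into this position, see
  \<open>orient\<close>.\<close>

locale embedding =
  fixes n :: nat and P Q :: "nat \<Rightarrow> bool" and x y :: "vtx \<Rightarrow> real"
  assumes n8: "8 \<le> n"
    and emb: "\<And>u v. inV n P Q u \<Longrightarrow> inV n P Q v \<Longrightarrow> u \<noteq> v \<Longrightarrow> link n u v \<longleftrightarrow> near x y u v"
    and start: "y (Hd 0) + 1 < y (Ht 0)" "x Cw + 1 < x (Hu 0)"
begin

definition vb :: "nat \<Rightarrow> vtx" where
  "vb j = (if j = 0 then Ht 0 else Vr j)"

lemma adj: "link n u v \<Longrightarrow> inV n P Q u \<Longrightarrow> inV n P Q v \<Longrightarrow> near x y u v"
  using emb link_irrefl by metis

lemma non_adj: "\<not> link n u v \<Longrightarrow> inV n P Q u \<Longrightarrow> inV n P Q v \<Longrightarrow> u \<noteq> v \<Longrightarrow> \<not> near x y u v"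
  using emb by metis

lemma near_swap: "near y x u v \<longleftrightarrow> near x y u v"
  by (auto simp: near_def)

text \<open>The two cycles of the initial ladder share the edge between \<open>Ht 0\<close> and
  \<open>Cw\<close>. The one through \<open>Hu 0\<close> is placed by \<open>start\<close>; the one
  through \<open>Vu 0\<close> is then forced to stand upward, which is the starting position of the
  vertical chain.\<close>

lemma orientation: "x (Ht 0) < x (Hu 0)" "x (Hd 0) < x (Hu 0)"
  "y (Ht 0) < y (Vu 0)" "y (Vl 0) < y (Vu 0)" "x (Vl 0) + 1 < x (Ht 0)"
  "y (Hu 0) < y (Ht 0)" "x (Vu 0) < x (Ht 0)"
proof -
  have n: "near x y (Ht 0) Cw" "near x y (Hd 0) Cw" "near x y (Vl 0) Cw" "near x y (Ht 0) (Hu 0)"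
    "near x y (Hd 0) (Hu 0)" "near x y (Ht 0) (Vu 0)" "near x y (Vl 0) (Vu 0)"
    using n8 by (simp_all add: adj link_def inV_def)
  have f: "\<not> near x y (Ht 0) (Vl 0)" "\<not> near x y (Vu 0) Cw" "\<not> near x y (Hu 0) (Vu 0)"
    using n8 by (simp_all add: non_adj link_def inV_def)
  show 1: "x (Ht 0) < x (Hu 0)" "x (Hd 0) < x (Hu 0)" "y (Hu 0) < y (Ht 0)"
    using n start unfolding near_def by linarith+
  have wt: "x Cw < x (Ht 0)" "y Cw < y (Ht 0)"
    using n start unfolding near_def by linarith+
  \<comment> \<open>Otherwise \<open>Vu 0\<close> lies, like \<open>Hu 0\<close>, in the lower right
    quadrant of \<open>Ht 0\<close>, and the two would be adjacent.\<close>
  have "\<not> \<bar>x (Vu 0) - x Cw\<bar> > 1"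
  proof
    assume a: "\<bar>x (Vu 0) - x Cw\<bar> > 1"
    then have b: "x Cw + 1 < x (Vu 0)" using n wt unfolding near_def by linarith
    then have "\<bar>y (Ht 0) - y (Vl 0)\<bar> > 1" using n(1,3,6,7) f(1) unfolding near_def by linarith
    then have "y (Vl 0) + 1 < y (Ht 0)" using n start wt unfolding near_def by linarith
    then show False using b n f(3) start 1 unfolding near_def by linarith
  qed
  then have "\<bar>y (Vu 0) - y Cw\<bar> > 1" using f(2) by (auto simp: near_def)
  then have b: "y Cw + 1 < y (Vu 0)" using n wt unfolding near_def by linarith
  then show c: "y (Ht 0) < y (Vu 0)" "y (Vl 0) < y (Vu 0)" using n unfolding near_def by linarith+
  have "\<bar>x (Ht 0) - x (Vl 0)\<bar> > 1" using n(1,3,6,7) b f(1) unfolding near_def by linarith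
  then show "x (Vl 0) + 1 < x (Ht 0)" "x (Vu 0) < x (Ht 0)" using n wt unfolding near_def by linarith+
qed

lemma H:
  assumes "j < n + 2"
  shows "x (Hu j) + 1 < x (Hu (Suc j))" "x (Ht j) + 1 < x (Ht (Suc j))"
    "\<bar>y (Hu (Suc j)) - y (Hu j)\<bar> < 1" "y (Ht (Suc j)) \<le> y (Hu j) + 1"
    "y (Hu j) < y (Ht j)" "y (Hu j) < y (Ht (Suc j))" "y (Hu (Suc j)) < y (Ht (Suc j))"
    "x (Ht j) < x (Hu j)" "x (Hu j) < x (Ht (Suc j))" "x (Ht (Suc j)) < x (Hu (Suc j))"
proof -
  have near: "near x y (Hu i) (Ht i) \<and> near x y (Hu i) (Hd i) \<and> near x y (Hu i) (Ht (Suc i)) \<and>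
      near x y (Hu i) (Hd (Suc i)) \<and> near x y (Ht (Suc i)) (Hu (Suc i)) \<and> near x y (Hd (Suc i)) (Hu (Suc i)) \<and>
      near x y (Hd i) (Hf i) \<and> near x y (Hd (Suc i)) (Hf i)" if "i < n + 2" for i
    using that by (simp add: adj link_def inV_def)
  have far: "\<not> near x y (Ht i) (Ht (Suc i)) \<and> \<not> near x y (Ht i) (Hd (Suc i)) \<and>
      \<not> near x y (Hd i) (Ht (Suc i)) \<and> \<not> near x y (Hd i) (Hd (Suc i)) \<and> \<not> near x y (Ht (Suc i)) (Hd (Suc i)) \<and>
      \<not> near x y (Hu i) (Hu (Suc i)) \<and> \<not> near x y (Hu i) (Hf i)" if "i < n + 2" for i
    using that by (simp add: non_adj link_def inV_def)
  note c = chain[of "n + 2" x y Hu Ht Hd Hf, OF near far orientation(1,2) start(1) assms]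
  show "x (Hu j) + 1 < x (Hu (Suc j))" "x (Ht j) + 1 < x (Ht (Suc j))"
    "\<bar>y (Hu (Suc j)) - y (Hu j)\<bar> < 1" "y (Ht (Suc j)) \<le> y (Hu j) + 1"
    "y (Hu j) < y (Ht j)" "y (Hu j) < y (Ht (Suc j))" "y (Hu (Suc j)) < y (Ht (Suc j))"
    "x (Ht j) < x (Hu j)" "x (Hu j) < x (Ht (Suc j))" "x (Ht (Suc j)) < x (Hu (Suc j))"
    using c by simp_all
qed

lemma V:
  assumes "j < n + 1"
  shows "y (Vu j) + 1 < y (Vu (Suc j))" "y (vb j) + 1 < y (vb (Suc j))"
    "\<bar>x (Vu (Suc j)) - x (Vu j)\<bar> < 1" "x (vb (Suc j)) \<le> x (Vu j) + 1"
    "x (Vu j) < x (vb j)" "x (Vu j) < x (vb (Suc j))" "x (Vu (Suc j)) < x (vb (Suc j))"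
    "y (vb j) < y (Vu j)" "y (Vu j) < y (vb (Suc j))" "y (vb (Suc j)) < y (Vu (Suc j))"
proof -
  have near: "near y x (Vu i) (vb i) \<and> near y x (Vu i) (Vl i) \<and> near y x (Vu i) (vb (Suc i)) \<and>
      near y x (Vu i) (Vl (Suc i)) \<and> near y x (vb (Suc i)) (Vu (Suc i)) \<and> near y x (Vl (Suc i)) (Vu (Suc i)) \<and>
      near y x (Vl i) (Vf i) \<and> near y x (Vl (Suc i)) (Vf i)" if "i < n + 1" for i
    using that by (simp add: adj link_def inV_def vb_def near_swap)
  have far: "\<not> near y x (vb i) (vb (Suc i)) \<and> \<not> near y x (vb i) (Vl (Suc i)) \<and>
      \<not> near y x (Vl i) (vb (Suc i)) \<and> \<not> near y x (Vl i) (Vl (Suc i)) \<and> \<not> near y x (vb (Suc i)) (Vl (Suc i)) \<and>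
      \<not> near y x (Vu i) (Vu (Suc i)) \<and> \<not> near y x (Vu i) (Vf i)" if "i < n + 1" for i
    using that by (simp add: non_adj link_def inV_def vb_def near_swap)
  have o: "y (vb 0) < y (Vu 0)" "x (Vl 0) + 1 < x (vb 0)" using orientation by (simp_all add: vb_def)
  note c = chain[of "n + 1" y x Vu vb Vl Vf, OF near far o(1) orientation(4) o(2) assms]
  show "y (Vu j) + 1 < y (Vu (Suc j))" "y (vb j) + 1 < y (vb (Suc j))"
    "\<bar>x (Vu (Suc j)) - x (Vu j)\<bar> < 1" "x (vb (Suc j)) \<le> x (Vu j) + 1"
    "x (Vu j) < x (vb j)" "x (Vu j) < x (vb (Suc j))" "x (Vu (Suc j)) < x (vb (Suc j))"
    "y (vb j) < y (Vu j)" "y (Vu j) < y (vb (Suc j))" "y (vb (Suc j)) < y (Vu (Suc j))"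
    using c by simp_all
qed

section \<open>Speeds of the chains and of the path\<close>

lemma x_Ht: "i \<le> j \<Longrightarrow> j \<le> n + 2 \<Longrightarrow> x (Ht i) + (real j - real i) \<le> x (Ht j)"
  using increments[of "n + 2" "\<lambda>j. x (Ht j)" 1 i j] H(2) by (force intro: less_imp_le)

lemma y_Hu: "i \<le> j \<Longrightarrow> j \<le> n + 2 \<Longrightarrow> y (Hu j) \<le> y (Hu i) + (real j - real i)"
  using increments[of "n + 2" "\<lambda>j. - y (Hu j)" "- 1" i j] H(3) by (force simp: abs_less_iff intro: less_imp_le)

lemma y_vb: "i \<le> j \<Longrightarrow> j \<le> n + 1 \<Longrightarrow> y (vb i) + (real j - real i) \<le> y (vb j)"
  using increments[of "n + 1" "\<lambda>j. y (vb j)" 1 i j] V(2) by (force intro: less_imp_le)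

lemma x_Vu: "i \<le> j \<Longrightarrow> j \<le> n + 1 \<Longrightarrow> x (Vu j) \<le> x (Vu i) + (real j - real i)"
  using increments[of "n + 1" "\<lambda>j. - x (Vu j)" "- 1" i j] V(3) by (force simp: abs_less_iff intro: less_imp_le)

lemma Ru_step:
  assumes "2 \<le> j" "j < n + 1"
  shows "near x y (Ru j) (Ru (Suc j))"
  using assms by (intro adj) (auto simp: link_def inV_def)

lemma x_Ru:
  assumes "2 \<le> i" "i \<le> j" "j \<le> n + 1"
  shows "x (Ru j) \<le> x (Ru i) + (real j - real i)"
  using assms(2,3)
proof (induction j rule: dec_induct)
  case (step j)
  then show ?case using Ru_step[of j] assms(1) by (auto simp: near_def)
qed simp

lemma y_Ru:
  assumes "2 \<le> i" "i \<le> j" "j \<le> n + 1"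
  shows "y (Ru j) \<le> y (Ru i) + (real j - real i)"
  using assms(2,3)
proof (induction j rule: dec_induct)
  case (step j)
  then show ?case using Ru_step[of j] assms(1) by (auto simp: near_def)
qed simp

text \<open>\<open>Cx\<close> has two neighbours on the horizontal chain: \<open>Ht (n + 2)\<close>
  pulls it to the right, \<open>Ht (n + 1)\<close> keeps it low. \<open>Cy\<close> passes this on to
  \<open>vb (n + 1)\<close> and \<open>Ru (n + 1)\<close>, and \<open>vb (n + 1)\<close> in turn
  lifts \<open>Cy\<close> and with it the end of the path.\<close>

lemma end_bounds:
  "x (Ht n) - 2 < x (Vu n)" "y (vb n) < y (Hu n) + 3"
  "x (Ht n) - 1 < x (Ru (n + 1))" "y (vb n) - 1 < y (Ru (n + 1))"
proof -
  have c: "near x y Cx (Ht (n + 1))" "near x y Cx (Ht (n + 2))" "near x y Cx Cy"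
    "near x y Cy (vb (n + 1))" "near x y Cy (Ru (n + 1))"
    by (simp_all add: adj link_def inV_def vb_def)
  have h: "x (Ht n) + 1 < x (Ht (n + 1))" "x (Ht (n + 1)) + 1 < x (Ht (n + 2))" "y (Ht (n + 1)) \<le> y (Hu n) + 1"
    using H[of n] H[of "n + 1"] by simp_all
  have v: "y (vb n) + 1 < y (vb (n + 1))" "x (vb (n + 1)) \<le> x (Vu n) + 1"
    using V[of n] by simp_all
  show "x (Ht n) - 2 < x (Vu n)" "y (vb n) < y (Hu n) + 3"
    "x (Ht n) - 1 < x (Ru (n + 1))" "y (vb n) - 1 < y (Ru (n + 1))"
    using c h v unfolding near_def by linarith+
qed

text \<open>Between levels \<open>j\<close> and \<open>n\<close> the first coordinate of
  \<open>Ht\<close> gains at least \<open>n - j\<close> and that of \<open>Vu\<close> at most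
  \<open>n - j\<close>, so the bound at the far end carries back to \<open>j\<close>; heights behave
  alike with \<open>vb\<close> and \<open>Hu\<close>.\<close>

lemma width:
  assumes "j \<le> n"
  shows "x (Ht j) - 2 < x (Vu j)" "y (vb j) < y (Hu j) + 3"
  using end_bounds x_Ht[of j n] x_Vu[of j n] y_vb[of j n] y_Hu[of j n] assms by simp_all

text \<open>The path never gains on the chains, so its initial lag persists. Its numbering starts at
  2 because \<open>Ru 2\<close> is within 1 of \<open>Ht 0\<close> while \<open>Ht 2\<close> and
  \<open>vb 2\<close> are already more than 2 ahead of \<open>Ht 0\<close>.\<close>

lemma Ru_upper:
  assumes "2 \<le> j" "j \<le> n + 1"
  shows "x (Ru j) < x (Ht j) - 1" "y (Ru j) < y (vb j) - 1"
proof -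
  have "near x y (Ht 0) (Ru 2)" by (intro adj) (auto simp: link_def inV_def)
  moreover have "x (Ht 0) + 1 < x (Ht 1)" "x (Ht 1) + 1 < x (Ht 2)" "y (vb 0) + 1 < y (vb 1)" "y (vb 1) + 1 < y (vb 2)"
    using H(2)[of 0] H(2)[of 1] V(2)[of 0] V(2)[of 1] n8 by (simp_all add: numeral_2_eq_2)
  ultimately have "x (Ru 2) < x (Ht 2) - 1" "y (Ru 2) < y (vb 2) - 1"
    by (auto simp: near_def vb_def)
  then show "x (Ru j) < x (Ht j) - 1" "y (Ru j) < y (vb j) - 1"
    using x_Ru[of 2 j] y_Ru[of 2 j] x_Ht[of 2 j] y_vb[of 2 j] assms by simp_all
qed

text \<open>The same race read backward from the far end: going down one level the chains lose more
  than 1, the path at most 1.\<close>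

lemma Ru_lower:
  assumes "1 \<le> j" "j \<le> n"
  shows "x (Ht j) - 1 < x (Ru (Suc j))" "y (vb j) - 1 < y (Ru (Suc j))"
  using end_bounds x_Ru[of "Suc j" "n + 1"] y_Ru[of "Suc j" "n + 1"] x_Ht[of j n] y_vb[of j n] assms by simp_all

text \<open>Both sides of the corridor start at \<open>Ht 0\<close>, which is \<open>vb 0\<close>;
  from there \<open>vb\<close> climbs more than 1 per level and the nodes \<open>Hu\<close> less
  than 1.\<close>

lemma vb_above_Ht: "1 \<le> j \<Longrightarrow> j \<le> n \<Longrightarrow> y (Ht j) < y (vb j)"
proof -
  assume j: "1 \<le> j" "j \<le> n"
  have "y (Ht j) \<le> y (Hu (j - 1)) + 1" using H(4)[of "j - 1"] j by simp
  moreover have "y (Hu (j - 1)) \<le> y (Hu 0) + (real j - 1)" using y_Hu[of 0 "j - 1"] j by (simp add: of_nat_diff)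
  moreover have "y (vb 0) + real j \<le> y (vb j)" using y_vb[of 0 j] j by simp
  ultimately show ?thesis using orientation(6) by (simp add: vb_def)
qed

lemma Ht_right_of_vb: "1 \<le> j \<Longrightarrow> j \<le> n \<Longrightarrow> x (vb j) < x (Ht j)"
proof -
  assume j: "1 \<le> j" "j \<le> n"
  have "x (vb j) \<le> x (Vu (j - 1)) + 1" using V(4)[of "j - 1"] j by simp
  moreover have "x (Vu (j - 1)) \<le> x (Vu 0) + (real j - 1)" using x_Vu[of 0 "j - 1"] j by (simp add: of_nat_diff)
  moreover have "x (Ht 0) + real j \<le> x (Ht j)" using x_Ht[of 0 j] j by simp
  ultimately show ?thesis using orientation(7) by (simp add: vb_def)
qed

text \<open>The vertex \<open>Ru (Suc j)\<close> is too close to \<open>Ht j\<close> in the first coordinate and to \<open>vb j\<close> in the second,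
  so it is separated from each of them in the other coordinate.\<close>
lemma Ru_between:
  assumes "2 \<le> j" "j \<le> n"
  shows "y (Ht j) + 1 < y (Ru (Suc j))" "x (vb j) + 1 < x (Ru (Suc j))"
proof -
  have f: "\<not> near x y (Ht j) (Ru (Suc j))" "\<not> near x y (vb j) (Ru (Suc j))"
    using assms by (auto simp: non_adj link_def inV_def vb_def)
  have u: "x (Ru (Suc j)) < x (Ht (Suc j)) - 1" "y (Ru (Suc j)) < y (vb (Suc j)) - 1"
    using Ru_upper[of "Suc j"] assms by auto
  have l: "x (Ht j) - 1 < x (Ru (Suc j))" "y (vb j) - 1 < y (Ru (Suc j))"
    using Ru_lower[of j] assms by auto
  have "near x y (Hu j) (Ht j)" "near x y (Hu j) (Ht (Suc j))" "near x y (Vu j) (vb j)" "near x y (Vu j) (vb (Suc j))"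
    using assms by (simp_all add: adj link_def inV_def vb_def)
  then have s: "x (Ht (Suc j)) \<le> x (Ht j) + 2" "y (vb (Suc j)) \<le> y (vb j) + 2"
    unfolding near_def by linarith+
  have o: "y (Ht j) < y (vb j)" "x (vb j) < x (Ht j)"
    using vb_above_Ht Ht_right_of_vb assms by auto
  show "y (Ht j) + 1 < y (Ru (Suc j))" using f(1) u(1) l s(1) o(1) unfolding near_def by linarith
  show "x (vb j) + 1 < x (Ru (Suc j))" using f(2) u(2) l s(2) o(2) unfolding near_def by linarith
qed

section \<open>Boxes and the pendants inside them\<close>

definition box :: "nat \<Rightarrow> vtx \<Rightarrow> bool" where
  "box k v \<longleftrightarrow> x (Ht k) - 2 \<le> x v \<and> x v < x (Ht k) - 1 \<and> y (Hu k) < y v \<and> y v < y (vb k) - 2"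

text \<open>Horizontally a box is a half-open interval of length 1; vertically it is shorter than 1
  by \<open>width\<close>. This is how the narrowness of the corridor limits its capacity.\<close>

lemma box_near: "box k u \<Longrightarrow> box k v \<Longrightarrow> k \<le> n \<Longrightarrow> near x y u v"
  using width[of k] unfolding box_def near_def by linarith

text \<open>The path fills the lower left and upper right quadrants of \<open>Ru k\<close>, so its
  pendants are an upper left \<open>t\<close> and a lower right \<open>s\<close>. The corridor
  confines \<open>t\<close> below \<open>vb k\<close> and to the right of \<open>vb m\<close>. The
  pendant \<open>s\<close> avoids \<open>Ht k\<close> on the left or from above; not being adjacent
  to \<open>t\<close>, it is pushed down into box \<open>k\<close> in the former case and right into
  box \<open>Suc k\<close> in the latter.\<close>

lemma Ru_pendant_box:
  assumes "Q k" "4 \<le> k" "k < n"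
  shows "\<exists>p\<in>{Rn k, Rs k}. box k p \<or> box (Suc k) p"
proof -
  obtain m where m: "k = Suc m" "3 \<le> m" using assms by (cases k) auto
  have adjR: "near x y (Ru k) (Ru m)" "near x y (Ru k) (Ru (Suc k))" "near x y (Ru k) (Rn k)" "near x y (Ru k) (Rs k)"
    using assms m by (simp_all add: adj link_def inV_def)
  have up: "x (Ru m) < x (Ht m) - 1" "y (Ru m) < y (vb m) - 1" "x (Ru k) < x (Ht k) - 1" "y (Ru k) < y (vb k) - 1"
      "y (Ru (Suc k)) < y (vb (Suc k)) - 1"
    using Ru_upper[of m] Ru_upper[of k] Ru_upper[of "Suc k"] assms m by auto
  have lo: "x (Ht m) - 1 < x (Ru k)" "y (vb m) - 1 < y (Ru k)" 
      "x (Ht k) - 1 < x (Ru (Suc k))" "y (vb k) - 1 < y (Ru (Suc k))" 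
    using Ru_lower[of m] Ru_lower[of k] assms m by auto
  have bt: "y (Ht m) + 1 < y (Ru k)" "x (vb m) + 1 < x (Ru k)" "x (vb k) + 1 < x (Ru (Suc k))"
    using Ru_between[of m] Ru_between[of k] assms m by auto
  have h: "y (Hu k) < y (Ht k)" "y (Hu m) < y (Ht m)" "y (Hu k) < y (Hu m) + 1" "y (Hu (Suc k)) < y (Hu k) + 1"
      "y (Ht k) \<le> y (Hu m) + 1" "x (Ht m) + 1 < x (Ht k)" "x (Ht k) + 1 < x (Ht (Suc k))"
      "x (Ht k) \<le> x (Ht m) + 2"
    using H[of m] H[of k] assms m adj[of "Hu m" "Ht k"] adj[of "Hu m" "Ht m"]
    by (auto simp: near_def link_def inV_def)
  have v: "x (Vu k) < x (vb k)" "x (Vu m) < x (vb m)" "x (Vu k) < x (Vu m) + 1" "x (Vu (Suc k)) < x (Vu k) + 1"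
      "y (vb k) \<le> y (vb m) + 2"
    using V[of m] V[of k] assms m adj[of "Vu m" "vb k"] adj[of "Vu m" "vb m"]
    by (auto simp: near_def link_def inV_def vb_def)
  have w: "x (Ht k) - 2 < x (Vu k)" "y (vb k) < y (Hu k) + 3" "x (Ht (Suc k)) - 2 < x (Vu (Suc k))"
    using width[of k] width[of "Suc k"] assms by auto
  have "\<exists>s\<in>{Rn k, Rs k}. \<exists>t\<in>{Rn k, Rs k}. x (Ru k) < x s \<and> y s < y (Ru k) \<and> x t < x (Ru k) \<and> y (Ru k) < y t"
  proof -
    have f: "\<not> near x y (Ru m) (Rn k)" "\<not> near x y (Ru m) (Rs k)" "\<not> near x y (Ru (Suc k)) (Rn k)" 
       "\<not> near x y (Ru (Suc k)) (Rs k)" "\<not> near x y (Rn k) (Rs k)"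
      using assms m by (simp_all add: non_adj link_def inV_def)
    have s: "x (Ru m) < x (Ru k)" "y (Ru m) < y (Ru k)" "x (Ru k) < x (Ru (Suc k))" "y (Ru k) < y (Ru (Suc k))"
      using up lo by linarith+
    have *: "x (Ru k) < x p \<and> y p < y (Ru k) \<or> x p < x (Ru k) \<and> y (Ru k) < y p" if "p \<in> {Rn k, Rs k}" for p
    proof -
      have "near x y (Ru k) p" "\<not> near x y (Ru m) p" "\<not> near x y (Ru (Suc k)) p" using that adjR f by auto
      then show ?thesis using s adjR(1,2) unfolding near_def by linarith
    qed
    from *[of "Rn k"] *[of "Rs k"] show ?thesis
      using f(5) adjR(3,4) unfolding near_def by auto
  qed
  then obtain s t where st: "s \<in> {Rn k, Rs k}" "t \<in> {Rn k, Rs k}" 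
    "x (Ru k) < x s" "y s < y (Ru k)" "x t < x (Ru k)" "y (Ru k) < y t" by blast
  have V: "inV n P Q s" "inV n P Q t" using st assms by (auto simp: inV_def)
  have ns: "near x y (Ru k) s" "near x y (Ru k) t" using st adjR by auto
  have f: "\<not> near x y s t" "\<not> near x y t (vb k)" "\<not> near x y t (vb m)" "\<not> near x y s (Ht k)" "\<not> near x y s (Ht m)"
      "\<not> near x y s (Ru (Suc k))"
    using st assms m by (auto simp: non_adj link_def inV_def vb_def)
  \<comment> \<open>The corridor is so narrow that \<open>t\<close> is horizontally within 1 of
    \<open>vb k\<close>; non-adjacency then puts it below.\<close>
  have t: "y t + 1 < y (vb k)"
    using f(2) ns(2) st(5,6) adjR(2) up bt v w unfolding near_def by linarith
  have t': "x (vb m) + 1 < x t"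
    using f(3) ns(2) st(5,6) t up lo bt v unfolding near_def by linarith
  have "x s < x (Ht k) - 1 \<or> y (Ht k) + 1 < y s"
    using f(4) ns(1) st(3,4) up lo bt h adjR(2) unfolding near_def by linarith
  then show ?thesis
  proof
    assume a: "x s < x (Ht k) - 1"
    have "y s + 1 < y t" using a f(1) t' v w ns st unfolding near_def by linarith
    moreover have "y (Ht m) + 1 < y s"
      using a f(5) ns(1) st(3,4) up lo bt h unfolding near_def by linarith
    moreover have "x (Ht k) - 2 \<le> x s" using lo(3) adjR(2) st(3) unfolding near_def by linarith
    ultimately have "box k s" using a t h unfolding box_def by linarith
    then show ?thesis using st(1) by blast
  next
    assume b: "y (Ht k) + 1 < y s"
    have "x t + 1 < x s" using b f(1) t h w ns st unfolding near_def by linarith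
    moreover have "y s + 1 < y (Ru (Suc k))"
      using f(6) ns(1) st(3,4) adjR(2) up lo unfolding near_def by linarith
    ultimately have "box (Suc k) s"
      using b t' up(3,5) h v w ns(1) unfolding box_def near_def by linarith
    then show ?thesis using st(1) by blast
  qed
qed

text \<open>Both lower quadrants of \<open>Ht j\<close> belong to \<open>Hu i\<close> and
  \<open>Hu j\<close>, so its pendants lie above it, and one of them, \<open>z\<close>, not to its
  left. If \<open>z\<close> avoids \<open>Ht (Suc j)\<close> on the left, it stays below
  \<open>Ru (Suc j)\<close> and is in box \<open>Suc j\<close>. If it avoids it from above, it is to
  the right of \<open>Ru (Suc j)\<close> and below \<open>Ru (j + 2)\<close>, hence in box
  \<open>j + 2\<close>.\<close>

lemma Ht_pendant_box:
  assumes "P j" "4 \<le> j" "j + 2 \<le> n"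
  shows "\<exists>p\<in>{He j, Hw j}. box (Suc j) p \<or> box (j + 2) p"
proof -
  obtain i where i: "j = Suc i" "3 \<le> i" using assms by (cases j) auto
  have a: "near x y (Ht j) (Hu i)" "near x y (Ht j) (Hu j)" "near x y (Ht j) (He j)" "near x y (Ht j) (Hw j)"
      "near x y (Hu j) (Ht (Suc j))" "near x y (Ru (Suc j)) (Ru (j + 2))" "near x y (Ru (j + 2)) (Ru (j + 3))"
    using assms i by (simp_all add: adj link_def inV_def)
  have h: "x (Hu i) < x (Ht j)" "x (Ht j) < x (Hu j)" "y (Hu i) < y (Ht j)" "y (Hu j) < y (Ht j)"
      "x (Ht j) + 1 < x (Ht (Suc j))" "x (Ht (Suc j)) + 1 < x (Ht (j + 2))"
      "y (Hu (Suc j)) < y (Hu j) + 1" "y (Hu (j + 2)) < y (Hu (Suc j)) + 1"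
      "y (Hu (Suc j)) < y (Ht (Suc j))" "y (Ht (Suc j)) \<le> y (Hu j) + 1"
    using H[of i] H[of j] H[of "Suc j"] assms i by auto
  have r: "x (Ru (Suc j)) < x (Ht (Suc j)) - 1" "y (Ru (Suc j)) < y (vb (Suc j)) - 1"
      "y (Ru (j + 2)) < y (vb (j + 2)) - 1" "x (Ht j) - 1 < x (Ru (Suc j))" "x (Ht (Suc j)) - 1 < x (Ru (j + 2))"
      "y (vb (Suc j)) - 1 < y (Ru (j + 2))" "x (Ht (j + 2)) - 1 < x (Ru (j + 3))" "y (Ht j) + 1 < y (Ru (Suc j))"
    using Ru_upper[of "Suc j"] Ru_upper[of "j + 2"] Ru_lower[of j] Ru_lower[of "Suc j"] Ru_lower[of "j + 2"]
      Ru_between[of j] assms by (auto simp: numeral_3_eq_3)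
  have w: "y (vb (Suc j)) < y (Hu (Suc j)) + 3" using width[of "Suc j"] assms by auto
  have "\<exists>z\<in>{He j, Hw j}. x (Ht j) \<le> x z \<and> y (Ht j) < y z"
  proof -
    have f: "\<not> near x y (Hu i) (He j)" "\<not> near x y (Hu j) (He j)" "\<not> near x y (Hu i) (Hw j)"
      "\<not> near x y (Hu j) (Hw j)" "\<not> near x y (He j) (Hw j)"
      using assms i by (simp_all add: non_adj link_def inV_def)
    have "y (Ht j) < y (He j)" using f(1,2) a(1-3) h(1-4) unfolding near_def by linarith
    moreover have "y (Ht j) < y (Hw j)" using f(3,4) a(1,2,4) h(1-4) unfolding near_def by linarith
    moreover have "x (Ht j) \<le> x (He j) \<or> x (Ht j) \<le> x (Hw j)"
      using calculation f(5) a(3,4) unfolding near_def by linarith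
    ultimately show ?thesis by blast
  qed
  then obtain z where z: "z \<in> {He j, Hw j}" "x (Ht j) \<le> x z" "y (Ht j) < y z" by blast
  have az: "near x y (Ht j) z" using z(1) a by auto
  have f: "\<not> near x y z (Hu j)" "\<not> near x y z (Ht (Suc j))" "\<not> near x y z (Ru (Suc j))" "\<not> near x y z (Ru (j + 2))"
    using z(1) assms by (auto simp: non_adj link_def inV_def)
  have y: "y (Hu j) + 1 < y z" using f(1) z az a(2) h unfolding near_def by linarith
  have "x z < x (Ht (Suc j)) - 1 \<or> y (Ht (Suc j)) + 1 < y z"
    using f(2) z az h y unfolding near_def by linarith
  then show ?thesis
  proof
    assume b: "x z < x (Ht (Suc j)) - 1"
    have "y z + 1 < y (Ru (Suc j))"
      using f(3) b z az a(2,5,6) r unfolding near_def by linarith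
    then have "box (Suc j) z" using b z(2) a(2,5) y h r unfolding box_def near_def by linarith
    then show ?thesis using z(1) by blast
  next
    assume b: "y (Ht (Suc j)) + 1 < y z"
    have c: "x (Ru (Suc j)) + 1 < x z"
      using f(3) b z az a(2,5) h r w unfolding near_def by linarith
    have "y z + 1 < y (Ru (j + 2))"
      using f(4) b c z az a(6) h r unfolding near_def by linarith
    then have "box (j + 2) z" using b c z az a(6,7) h r unfolding box_def near_def by linarith
    then show ?thesis using z(1) by blast
  qed
qed

text \<open>\<open>z\<close> and \<open>p\<close> use up the boxes \<open>j + 1\<close> and
  \<open>j + 2\<close>, \<open>z'\<close> and \<open>r\<close> the boxes \<open>j + 3\<close> and
  \<open>j + 4\<close>; \<open>q\<close>, confined to the two middle boxes, finds no place. Without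
  \<open>q\<close> or without \<open>z\<close> and \<open>z'\<close> the boxes would
  suffice.\<close>

lemma contradiction:
  assumes P: "P j" "P (j + 2)" and Q: "Q (j + 1)" "Q (j + 2)" "Q (j + 3)" and j: "4 \<le> j" "j + 4 \<le> n"
  shows False
proof -
  obtain z where z: "z \<in> {He j, Hw j}" "box (j + 1) z \<or> box (j + 2) z"
    using Ht_pendant_box[of j] P j by auto
  obtain z' where z': "z' \<in> {He (j + 2), Hw (j + 2)}" "box (j + 3) z' \<or> box (j + 4) z'"
    using Ht_pendant_box[of "j + 2"] P j by (auto simp: numeral_eq_Suc)
  obtain p where p: "p \<in> {Rn (j + 1), Rs (j + 1)}" "box (j + 1) p \<or> box (j + 2) p"
    using Ru_pendant_box[of "j + 1"] Q j by auto
  obtain q where q: "q \<in> {Rn (j + 2), Rs (j + 2)}" "box (j + 2) q \<or> box (j + 3) q"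
    using Ru_pendant_box[of "j + 2"] Q j by (auto simp: numeral_eq_Suc)
  obtain r where r: "r \<in> {Rn (j + 3), Rs (j + 3)}" "box (j + 3) r \<or> box (j + 4) r"
    using Ru_pendant_box[of "j + 3"] Q j by (auto simp: numeral_eq_Suc)
  have ex: "\<not> (box k u \<and> box k v)" if "\<not> near x y u v" "k \<le> n" for k u v
    using that box_near by blast
  have "\<not> near x y z p" "\<not> near x y z q" "\<not> near x y z' q" "\<not> near x y z' r" "\<not> near x y p q" "\<not> near x y q r"
    using z(1) z'(1) p(1) q(1) r(1) P Q by (auto simp: non_adj link_def inV_def)
  then have "\<not> (box k z \<and> box k p)" "\<not> (box k z \<and> box k q)" "\<not> (box k z' \<and> box k q)" "\<not> (box k z' \<and> box k r)"
    "\<not> (box k p \<and> box k q)" "\<not> (box k q \<and> box k r)" if "k \<le> n" for k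
    using ex that by blast+
  from this[of "j + 1"] this[of "j + 2"] this[of "j + 3"] this[of "j + 4"] show False
    using z(2) z'(2) p(2) q(2) r(2) j by auto
qed

end

section \<open>Disjoint sets give a drawing\<close>

text \<open>All chains follow the diagonal. The function \<open>h\<close> is a linear drift of slope \<open>d\<close>, so small
  that it stays below all other gaps; it makes the strict inequalities of the chains possible.\<close>
primrec px :: "(nat \<Rightarrow> real) \<Rightarrow> real \<Rightarrow> nat \<Rightarrow> vtx \<Rightarrow> real" where
  "px h d n (Hu j) = real j + h j"
| "px h d n (Ht j) = (if j = 0 then - 1 / 10 else real j - 1 / 20 + h j)"
| "px h d n (Hd j) = (if j = 0 then - 1 / 2 else real j - 1 / 40 + h j)"
| "px h d n (Hf j) = (if j = 0 then 1 / 4 else real j + 1 / 2 + h j)"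
| "px h d n (He j) = real j - 1 / 20 + h j + d / 2"
| "px h d n (Hw j) = real j - 21 / 20 + h j + d / 4"
| "px h d n (Vu j) = (if j = 0 then - 1 / 4 - d else real j - 5 / 4 - h j)"
| "px h d n (Vr j) = real j - 5 / 4 - h j + d"
| "px h d n (Vl j) = (if j = 0 then - 6 / 5 else real j - 9 / 4 - h j)"
| "px h d n (Vf j) = (if j = 0 then - 3 / 2 else real j - 9 / 4 - h j - d)"
| "px h d n (Ru j) = real j - 23 / 20"
| "px h d n (Rn j) = real j - 6 / 5"
| "px h d n (Rs j) = real j - 11 / 10 + h j"
| "px h d n Cw = - 21 / 20"
| "px h d n Cx = real n + 19 / 20 + h (Suc n) + d"
| "px h d n Cy = real n + 7 / 10"

text \<open>For \<open>j\<close> at least 2, \<open>Ht j\<close> is exactly 1 above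
  \<open>Hu (j - 1)\<close> and \<open>1 + d\<close> above \<open>Hd j\<close>; \<open>Cx\<close> is
  exactly 1 above \<open>Ht (n + 1)\<close> and exactly 1 to the left of \<open>Ht (n + 2)\<close>.
  The offsets \<open>d / 4\<close> and \<open>d / 2\<close> in \<open>px\<close> lie between 0 and
  \<open>d\<close>, so that \<open>Hw j\<close> reaches \<open>Ht j\<close> but not
  \<open>He j\<close>, and \<open>He j\<close> stays short of \<open>Ht (Suc j)\<close>. Levels 0
  and 1 have values of their own, since the initial ladder does not fit the periodic
  pattern.\<close>

primrec py :: "(nat \<Rightarrow> real) \<Rightarrow> real \<Rightarrow> nat \<Rightarrow> vtx \<Rightarrow> real" where
  "py h d n (Hu j) = (if j = 0 then 6 / 5 else real j - h j)"
| "py h d n (Ht j) = (if j = 0 then 43 / 20 else if j = 1 then 5 / 4 else real j - h j + d)"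
| "py h d n (Hd j) = (if j = 0 then 1 / 2 else if j = 1 then 1 / 5 else real j - 1 - h j)"
| "py h d n (Hf j) = (if j = 0 then - 1 / 5 else real j - 1 - h j - d)"
| "py h d n (He j) = real j + 1 - h j + d"
| "py h d n (Hw j) = real j + 1 / 20"
| "py h d n (Vu j) = real j + 23 / 10 + h j"
| "py h d n (Vr j) = real j + 9 / 4 + h j"
| "py h d n (Vl j) = (if j = 0 then 2 else real j + 91 / 40 + h j)"
| "py h d n (Vf j) = (if j = 0 then 11 / 4 else real j + 14 / 5 + h j)"
| "py h d n (Ru j) = real j + 11 / 10"
| "py h d n (Rn j) = real j + 6 / 5 + h j"
| "py h d n (Rs j) = real j + 3 / 20"
| "py h d n Cw = 6 / 5"
| "py h d n Cx = real n + 2 - h (Suc n) + d"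
| "py h d n Cy = real n + 91 / 40 + h (Suc n)"

text \<open>The position along the diagonal. It reduces the check of all pairs to level differences
  0, 1 and at least 2, each a matter of linear arithmetic.\<close>

primrec level :: "nat \<Rightarrow> vtx \<Rightarrow> nat" where
  "level n (Hu j) = j"
| "level n (Ht j) = j"
| "level n (Hd j) = j"
| "level n (Hf j) = j"
| "level n (He j) = j"
| "level n (Hw j) = j"
| "level n (Vu j) = j"
| "level n (Vr j) = j"
| "level n (Vl j) = j"
| "level n (Vf j) = j"
| "level n (Ru j) = j"
| "level n (Rn j) = j"
| "level n (Rs j) = j"
| "level n Cw = 0"
| "level n Cx = Suc n"
| "level n Cy = Suc n"

lemmas pos_simps = px.simps py.simps level.simps simp_thms if_True if_False
  one_neq_zero zero_neq_one of_nat_0 of_nat_1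

text \<open>\<open>P_apart\<close> keeps \<open>He j\<close> away from \<open>Hw (Suc j)\<close>;
  \<open>PQ_apart\<close> keeps \<open>Rs j\<close> away from \<open>Hw j\<close> and
  \<open>Rs (Suc j)\<close> away from \<open>He j\<close>. The bound \<open>1 / 400\<close> on the
  total drift is a tenth of \<open>1 / 40\<close>, of which all fixed offsets in the coordinates are
  multiples.\<close>

locale drawing =
  fixes n :: nat and P Q :: "nat \<Rightarrow> bool" and d :: real
  assumes n8: "8 \<le> n"
    and P_bounds: "\<And>j. P j \<Longrightarrow> 4 \<le> j \<and> j < n"
    and Q_bounds: "\<And>j. Q j \<Longrightarrow> 5 \<le> j \<and> j < n"
    and P_apart: "\<And>j. P j \<Longrightarrow> \<not> P (Suc j)"
    and PQ_apart: "\<And>j k. P j \<Longrightarrow> Q k \<Longrightarrow> k \<noteq> j \<and> k \<noteq> Suc j"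
    and d: "0 < d" and d_small: "d * real (n + 2) \<le> 1 / 400"
begin

text \<open>Kept opaque in the coordinates because the product \<open>d * real j\<close> is not
  linear; the arithmetic sees only the recursion, the growth and the bounds of
  \<open>h\<close>.\<close>

definition h :: "nat \<Rightarrow> real" where
  "h j = d * real j"

definition close :: "vtx \<Rightarrow> vtx \<Rightarrow> bool" where
  "close u v \<longleftrightarrow> px h d n u \<le> px h d n v + 1 \<and> px h d n v \<le> px h d n u + 1 \<and>
     py h d n u \<le> py h d n v + 1 \<and> py h d n v \<le> py h d n u + 1"

lemma closeD:
  assumes "close u v"
  shows "px h d n u \<le> px h d n v + 1" "px h d n v \<le> px h d n u + 1"
    "py h d n u \<le> py h d n v + 1" "py h d n v \<le> py h d n u + 1"
  using assms by (auto simp: close_def)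

lemma h_0: "h 0 = 0" and h_1: "h 1 = d" and h_Suc: "h (Suc j) = h j + d" and h_nonneg: "0 \<le> h j"
  using d by (simp_all add: h_def algebra_simps)

lemma h_far:
  assumes "i + 2 \<le> j"
  shows "h i + 2 * d \<le> h j"
proof -
  have "d * (real i + 2) \<le> d * real j" using assms d by (intro mult_left_mono) auto
  then show ?thesis by (simp add: h_def algebra_simps)
qed

lemma h_le:
  assumes "j \<le> n + 2"
  shows "h j \<le> 1 / 400"
proof -
  have "d * real j \<le> d * real (n + 2)" using assms d by (intro mult_left_mono) auto
  then show ?thesis using d_small unfolding h_def by linarith
qed

lemma d_le: "d \<le> 1 / 4000"
proof -
  have "d * 10 \<le> d * real (n + 2)" using d n8 by (intro mult_left_mono) auto
  then show ?thesis using d_small by linarith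
qed

lemma level_le: "inV n P Q w \<Longrightarrow> level n w \<le> n + 2"
  using P_bounds[of "level n w"] Q_bounds[of "level n w"] n8 by (cases w) (auto simp: inV_def)

lemma h_bounds: "inV n P Q w \<Longrightarrow> h (level n w) \<le> 1 / 400" "inV n P Q w \<Longrightarrow> 0 \<le> h (level n w)"
  using level_le h_le h_nonneg by auto

lemma no_end: "\<not> P n" "\<not> P (Suc n)" "\<not> P (n + 2)" "\<not> Q n" "\<not> Q (Suc n)" "\<not> Q (n + 2)"
  using P_bounds Q_bounds by fastforce+

text \<open>Distinctness is included for the sake of injectivity: two vertices at one point are
  close, hence linked by \<open>close_imp_link\<close>, hence at different points.\<close>

lemma arc_imp_close:
  assumes "inV n P Q u" "inV n P Q v" "arc n u v"
  shows "close u v \<and> (px h d n u \<noteq> px h d n v \<or> py h d n u \<noteq> py h d n v)"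
proof -
  note facts = assms(1,2) P_bounds[of "level n u"] P_bounds[of "level n v"] Q_bounds[of "level n u"]
    Q_bounds[of "level n v"] d d_le h_bounds[OF assms(1)] h_bounds[OF assms(2)] h_nonneg[of n] h_le[of n] n8
  from assms(3) show ?thesis
    apply (cases u; cases v; simp)
    apply (insert facts)
    apply (auto simp: close_def inV_def h_0 h_Suc split: if_splits)
    done
qed

lemma level_0_cases:
  assumes "inV n P Q w" "level n w = 0"
    and "w = Hu 0 \<Longrightarrow> R" "w = Ht 0 \<Longrightarrow> R" "w = Hd 0 \<Longrightarrow> R" "w = Hf 0 \<Longrightarrow> R"
    "w = Vu 0 \<Longrightarrow> R" "w = Vl 0 \<Longrightarrow> R" "w = Vf 0 \<Longrightarrow> R" "w = Cw \<Longrightarrow> R"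
  shows R
  using assms P_bounds[of 0] Q_bounds[of 0] n8 by (cases w) (auto simp: inV_def)

lemma level_1_cases:
  assumes "inV n P Q w" "level n w = 1"
    and "w = Hu 1 \<Longrightarrow> R" "w = Ht 1 \<Longrightarrow> R" "w = Hd 1 \<Longrightarrow> R" "w = Hf 1 \<Longrightarrow> R"
    "w = Vu 1 \<Longrightarrow> R" "w = Vr 1 \<Longrightarrow> R" "w = Vl 1 \<Longrightarrow> R" "w = Vf 1 \<Longrightarrow> R"
  shows R
  using assms P_bounds[of 1] Q_bounds[of 1] n8 by (cases w) (auto simp: inV_def)

lemma close_imp_link_eq:
  assumes inV: "inV n P Q u" "inV n P Q v" "u \<noteq> v" and close: "close u v" and eq: "level n u = level n v"
  shows "link n u v"
proof -
  note close = closeD[OF close] and params = d d_le h_bounds[OF inV(1)] h_bounds[OF inV(2)] h_0 h_1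
  have X: "real (level n v) = real (level n u)" "h (level n v) = h (level n u)"
    "\<not> (P (level n u) \<and> Q (level n v))" "\<not> (Q (level n u) \<and> P (level n v))"
    "P (level n u) \<longrightarrow> level n v < n" "P (level n v) \<longrightarrow> level n u < n" "Q (level n u) \<longrightarrow> level n v < n" "Q (level n v) \<longrightarrow> level n u < n"
    using eq PQ_apart[of "level n u" "level n u"] P_bounds[of "level n u"] Q_bounds[of "level n u"] by auto
  consider "level n u = 0" | "level n u = 1" | "level n u \<noteq> 0" "level n u \<noteq> 1" by blast
  then show ?thesis
  proof cases
    case 1
    then have j: "level n v = 0" using eq by simp
    show ?thesis
      by (insert close params eq 1; rule level_0_cases[OF inV(1) 1]; rule level_0_cases[OF inV(2) j];
          ((simp only: pos_simps; linarith) | (use eq inV no_end n8 in \<open>simp add: link_def inV_def\<close>)))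
  next
    case 2
    then have j: "level n v = 1" using eq by simp
    show ?thesis
      by (insert close params eq 2; rule level_1_cases[OF inV(1) 2]; rule level_1_cases[OF inV(2) j];
          ((simp only: pos_simps; linarith) | (use eq inV no_end n8 in \<open>simp add: link_def inV_def\<close>)))
  next
    case 3
    with eq have "(level n u = 0) = False" "(level n u = 1) = False"
      "(level n v = 0) = False" "(level n v = 1) = False" by auto
    with close params X(1,2) show ?thesis
      by (cases u; cases v;
          ((simp only: pos_simps; linarith) | (use eq X(3-) inV no_end n8 in \<open>simp add: link_def inV_def\<close>)))
  qed
qed

lemma close_imp_link_step:
  assumes inV: "inV n P Q u" "inV n P Q v" "u \<noteq> v" and close: "close u v" and step: "level n v = Suc (level n u)"
  shows "link n u v"
proof -
  note close = closeD[OF close] and params = d d_le h_bounds[OF inV(1)] h_bounds[OF inV(2)] h_0 h_1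
  have X: "real (level n v) = real (level n u) + 1" "h (level n v) = h (level n u) + d"
    "\<not> (P (level n u) \<and> Q (level n v))" "\<not> (P (level n u) \<and> P (level n v))"
    "P (level n v) \<longrightarrow> level n u < n" "Q (level n v) \<longrightarrow> level n u < n"
    using step h_Suc[of "level n u"] PQ_apart[of "level n u" "level n v"] P_apart[of "level n u"]
      P_bounds[of "level n v"] Q_bounds[of "level n v"] by auto
  consider "level n u = 0" | "level n u = 1" | "level n u \<noteq> 0" "level n u \<noteq> 1" by blast
  then show ?thesis
  proof cases
    case 1
    then have j: "level n v = 1" using step by simp
    show ?thesis
      by (insert close params step 1; rule level_0_cases[OF inV(1) 1]; rule level_1_cases[OF inV(2) j];
          ((simp only: pos_simps; linarith) | (use step inV no_end n8 in \<open>simp add: link_def inV_def\<close>)))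
  next
    case 2
    then have j: "(level n v = 0) = False" "(level n v = 1) = False" and np: "\<not> P (level n v)" "\<not> Q (level n v)"
      using step P_bounds[of "level n v"] Q_bounds[of "level n v"] by auto
    show ?thesis
      by (insert 2 j close params X(1,2); rule level_1_cases[OF inV(1) 2]; cases v;
          ((simp only: pos_simps; linarith) | (use step np inV no_end n8 in \<open>simp add: link_def inV_def\<close>)))
  next
    case 3
    with step have "(level n u = 0) = False" "(level n u = 1) = False"
      "(level n v = 0) = False" "(level n v = 1) = False" by auto
    with close params X(1,2) show ?thesis
      by (cases u; cases v;
          ((simp only: pos_simps; linarith) | (use step X(3-) inV no_end n8 in \<open>simp add: link_def inV_def\<close>)))
  qed
qed

text \<open>\<open>Ht 0\<close> and \<open>Ru 2\<close> form the only linked pair with such levels;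
  every other pair is separated in at least one coordinate.\<close>

lemma close_imp_link_far:
  assumes inV: "inV n P Q u" "inV n P Q v" "u \<noteq> v" and close: "close u v" and far: "level n u + 2 \<le> level n v"
  shows "link n u v"
proof -
  note close = closeD[OF close] and params = d d_le h_bounds[OF inV(1)] h_bounds[OF inV(2)] h_0 h_1
  have X: "real (level n u) + 2 \<le> real (level n v)" "h (level n u) + 2 * d \<le> h (level n v)"
    "(level n v = 0) = False" "(level n v = 1) = False"
    and Y: "P (level n v) \<longrightarrow> level n u < n \<and> 4 \<le> level n v"
      "Q (level n v) \<longrightarrow> level n u < n \<and> 4 \<le> level n v"
    using far h_far P_bounds[of "level n v"] Q_bounds[of "level n v"] by auto
  consider "level n u = 0" | "level n u = 1" | "level n u \<noteq> 0" "level n u \<noteq> 1" by blast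
  then show ?thesis
  proof cases
    case 1
    show ?thesis
      by (insert X 1 close params; rule level_0_cases[OF inV(1) 1]; cases v;
          ((simp only: pos_simps; linarith) | (use far Y inV no_end n8 in \<open>simp add: link_def inV_def\<close>)))
  next
    case 2
    show ?thesis
      by (insert X 2 close params; rule level_1_cases[OF inV(1) 2]; cases v;
          ((simp only: pos_simps; linarith) | (use far Y inV no_end n8 in \<open>simp add: link_def inV_def\<close>)))
  next
    case 3
    then have "(level n u = 0) = False" "(level n u = 1) = False" by auto
    with close params X show ?thesis
      by (cases u; cases v;
          ((simp only: pos_simps; linarith) | (use far Y inV no_end n8 in \<open>simp add: link_def inV_def\<close>)))
  qed
qed

lemma close_imp_link:
  assumes "inV n P Q u" "inV n P Q v" "u \<noteq> v" "close u v"
  shows "link n u v"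
proof -
  have *: "link n u v"
    if uv: "inV n P Q u" "inV n P Q v" "u \<noteq> v" "close u v" and le: "level n u \<le> level n v" for u v
  proof -
    consider "level n u = level n v" | "level n v = Suc (level n u)" | "level n u + 2 \<le> level n v"
      using le by linarith
    then show ?thesis
      using close_imp_link_eq[OF uv] close_imp_link_step[OF uv] close_imp_link_far[OF uv]
      by cases
  qed
  have "close v u" "link n v u \<Longrightarrow> link n u v" using assms(4) by (auto simp: close_def link_def)
  then show ?thesis using *[of u v] *[of v u] assms nat_le_linear[of "level n u" "level n v"] by blast
qed

end

section \<open>Transport along an injection\<close>

text \<open>The theorem asks for natural numbers as vertices; the graphs are built on
  \<open>vtx\<close> and moved along \<open>to_nat\<close>.\<close>

definition map_E :: "('a \<Rightarrow> 'b) \<Rightarrow> ('a \<Rightarrow> 'a \<Rightarrow> bool) \<Rightarrow> 'b \<Rightarrow> 'b \<Rightarrow> bool" where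
  "map_E c E u v \<longleftrightarrow> (\<exists>a b. u = c a \<and> v = c b \<and> E a b)"

context
  fixes c :: "'a \<Rightarrow> 'b"
  assumes c: "inj c"
begin

lemma map_E_image [simp]: "map_E c E (c a) (c b) \<longleftrightarrow> E a b"
  using c by (auto simp: map_E_def dest: injD)

lemma simple_graph_map: "simple_graph (c ` V) (map_E c E) \<longleftrightarrow> simple_graph V E"
proof
  assume *: "simple_graph (c ` V) (map_E c E)"
  have "finite V" using * c by (auto simp: simple_graph_def finite_image_iff inj_on_subset)
  moreover have "E u v \<Longrightarrow> u \<in> V \<and> v \<in> V \<and> E v u \<and> u \<noteq> v" for u v
    using * c unfolding simple_graph_def by (metis map_E_image inj_image_mem_iff)
  ultimately show "simple_graph V E" unfolding simple_graph_def by blast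
next
  assume "simple_graph V E"
  then show "simple_graph (c ` V) (map_E c E)"
    using c unfolding simple_graph_def map_E_def by (fastforce dest: injD)
qed

lemma glue_V_map: "glue_V (c ` V) (c ` W) = c ` glue_V V W"
  by (auto simp: glue_V_def)

lemma glue_E_map: "glue_E (map_E c E) (map_E c F) = map_E c (glue_E E F)"
  by (auto simp: glue_E_def map_E_def fun_eq_iff)

lemma closed_nbhd_map: "closed_nbhd (c ` V) (map_E c E) (c ` S) = c ` closed_nbhd V E S"
  using c by (auto simp: closed_nbhd_def inj_image_mem_iff)

lemma graph_connected_map:
  assumes "graph_connected V E"
  shows "graph_connected (c ` V) (map_E c E)"
proof -
  have "(c u, c v) \<in> {(x, y). x \<in> c ` V \<and> y \<in> c ` V \<and> map_E c E x y}\<^sup>*"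
    if "(u, v) \<in> {(x, y). x \<in> V \<and> y \<in> V \<and> E x y}\<^sup>*" for u v
    using that
  proof (induction rule: rtrancl_induct)
    case (step v w)
    then have "(c v, c w) \<in> {(x, y). x \<in> c ` V \<and> y \<in> c ` V \<and> map_E c E x y}" by auto
    with step.IH show ?case by (rule rtrancl.rtrancl_into_rtrancl)
  qed simp
  then show ?thesis using assms unfolding graph_connected_def by blast
qed

lemma triangle_free_map: "triangle_free (c ` V) (map_E c E) \<longleftrightarrow> triangle_free V E"
  using c by (simp add: triangle_free_def inj_eq)

lemma unit_square_graph_map: "unit_square_graph (c ` V) (map_E c E) \<longleftrightarrow> unit_square_graph V E"
proof
  assume "unit_square_graph (c ` V) (map_E c E)"
  then obtain p where p: "inj_on p (c ` V)"
    "\<forall>u\<in>V. \<forall>v\<in>V. u \<noteq> v \<longrightarrow> (E u v \<longleftrightarrow> linf_dist (p (c u)) (p (c v)) \<le> 1)"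
    using c by (auto simp: unit_square_graph_def inj_eq)
  have "inj_on (p \<circ> c) V" using p(1) c by (auto intro: comp_inj_on inj_on_subset)
  then show "unit_square_graph V E" using p(2) unfolding unit_square_graph_def by (intro exI[of _ "p \<circ> c"]) simp
next
  assume "unit_square_graph V E"
  then obtain p where p: "inj_on p V"
    "\<forall>u\<in>V. \<forall>v\<in>V. u \<noteq> v \<longrightarrow> (E u v \<longleftrightarrow> linf_dist (p u) (p v) \<le> 1)"
    by (auto simp: unit_square_graph_def)
  have "inj_on (p \<circ> inv c) (c ` V)" using p(1) c by (auto simp: inj_on_def)
  then show "unit_square_graph (c ` V) (map_E c E)"
    using p(2) c unfolding unit_square_graph_def by (intro exI[of _ "p \<circ> inv c"]) (auto simp: inj_eq)
qed

lemma triangle_free_unit_square_map: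
  "triangle_free_unit_square (c ` V) (map_E c E) \<longleftrightarrow> triangle_free_unit_square V E"
  by (simp add: triangle_free_unit_square_def simple_graph_map triangle_free_map unit_square_graph_map)

end

section \<open>The glued graph\<close>

instance vtx :: countable
  by countable_datatype

abbreviation glued_V :: "nat \<Rightarrow> (nat \<Rightarrow> bool) \<Rightarrow> (nat \<Rightarrow> bool) \<Rightarrow> vtx set" where
  "glued_V n P Q \<equiv> {v. inV n P Q v}"

abbreviation glued_E :: "nat \<Rightarrow> (nat \<Rightarrow> bool) \<Rightarrow> (nat \<Rightarrow> bool) \<Rightarrow> vtx \<Rightarrow> vtx \<Rightarrow> bool" where
  "glued_E n P Q \<equiv> glue_E (EL n P) (ER n Q)"

lemma glued_E_iff:
  assumes "8 \<le> n"
  shows "glued_E n P Q u v \<longleftrightarrow> inV n P Q u \<and> inV n P Q v \<and> link n u v"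
  using glue_E_iff[of n P Q u v] assms by (simp add: inV_def)

lemma inV_cover:
  assumes "\<And>j. P j \<Longrightarrow> j \<le> n" "\<And>j. Q j \<Longrightarrow> j \<le> n"
  shows "glued_V n P Q \<subseteq> (\<lambda>(f, j). f j) `
    (set [Hu, Ht, Hd, Hf, He, Hw, Vu, Vr, Vl, Vf, Ru, Rn, Rs] \<times> {..n + 2}) \<union> set [Cw, Cx, Cy]" (is "_ \<subseteq> ?C")
proof
  fix v assume "v \<in> glued_V n P Q"
  then have "inV n P Q v" by simp
  then show "v \<in> ?C"
    using assms[of "level n v"] by (cases v) (auto simp: inV_def image_iff)
qed

lemma glued_V_card:
  assumes "\<And>j. P j \<Longrightarrow> j \<le> n" "\<And>j. Q j \<Longrightarrow> j \<le> n"
  shows "finite (glued_V n P Q)" "card (glued_V n P Q) \<le> 13 * (n + 3) + 3"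
proof -
  let ?K = "[Hu, Ht, Hd, Hf, He, Hw, Vu, Vr, Vl, Vf, Ru, Rn, Rs]"
  let ?C = "(\<lambda>(f, j). f j) ` (set ?K \<times> {..n + 2}) \<union> set [Cw, Cx, Cy]"
  have "card ?C \<le> card ((\<lambda>(f, j). f j) ` (set ?K \<times> {..n + 2})) + card (set [Cw, Cx, Cy])"
    by (rule card_Un_le)
  also have "\<dots> \<le> card (set ?K \<times> {..n + 2}) + length [Cw, Cx, Cy]"
    by (intro add_mono card_image_le card_length) auto
  also have "\<dots> \<le> length ?K * (n + 3) + 3"
    using card_length[of ?K] unfolding card_cartesian_product by (intro add_mono mult_mono) auto
  finally have "card ?C \<le> 13 * (n + 3) + 3" by simp
  moreover have "finite ?C" by simp
  ultimately show "finite (glued_V n P Q)" "card (glued_V n P Q) \<le> 13 * (n + 3) + 3"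
    using inV_cover[of P n Q, OF assms] card_mono[of ?C] by (meson finite_subset le_trans)+
qed

lemma glued_connected:
  assumes n: "8 \<le> n" and P: "\<And>j. P j \<Longrightarrow> j \<le> n" and Q: "\<And>j. Q j \<Longrightarrow> 2 \<le> j \<and> j \<le> n"
  shows "graph_connected (glued_V n P Q) (glued_E n P Q)"
proof -
  let ?R = "{(u, v). u \<in> glued_V n P Q \<and> v \<in> glued_V n P Q \<and> glued_E n P Q u v}"
  define reach where "reach v \<longleftrightarrow> (v, Hu 0) \<in> ?R\<^sup>*" for v
  note E = glued_E_iff[OF n]
  have ext: "reach u" if "reach v" "inV n P Q u" "inV n P Q v" "link n u v" for u v
    using that unfolding reach_def by (intro converse_rtrancl_into_rtrancl[of u v]) (auto simp: E)
  note [simp] = inV_def link_def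
  have Hu: "reach (Hu j)" if "j \<le> n + 2" for j
    using that
  proof (induction j)
    case 0
    then show ?case by (simp add: reach_def)
  next
    case (Suc j)
    have "reach (Ht (Suc j))" by (rule ext[of "Hu j"]) (use Suc in auto)
    then show ?case by (rule ext) (use Suc in auto)
  qed
  have Ht: "reach (Ht j)" if "j \<le> n + 2" for j by (rule ext[OF Hu]) (use that in auto)
  have Hd: "reach (Hd j)" if "j \<le> n + 2" for j by (rule ext[OF Hu]) (use that in auto)
  have Vu: "reach (Vu j)" if "j \<le> n + 1" for j
    using that
  proof (induction j)
    case 0
    show ?case by (rule ext[OF Ht[of 0]]) auto
  next
    case (Suc j)
    have "reach (Vr (Suc j))" by (rule ext[of "Vu j"]) (use Suc in auto)
    then show ?case by (rule ext) (use Suc in auto)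
  qed
  have Vl: "reach (Vl j)" if "j \<le> n + 1" for j by (rule ext[OF Vu]) (use that in auto)
  have Ru: "reach (Ru j)" if "2 \<le> j" "j \<le> n + 1" for j
    using that
  proof (induction j rule: dec_induct)
    case base
    show ?case by (rule ext[OF Ht[of 0]]) auto
  next
    case (step j)
    show ?case by (rule ext[of "Ru j"]) (use step in auto)
  qed
  have "reach v" if "inV n P Q v" for v
  proof (cases v)
    case (Hf j)
    show ?thesis unfolding Hf by (rule ext[OF Hd[of j]]) (use that Hf in auto)
  next
    case (He j)
    show ?thesis unfolding He by (rule ext[OF Ht[of j]]) (use that He P[of j] in auto)
  next
    case (Hw j)
    show ?thesis unfolding Hw by (rule ext[OF Ht[of j]]) (use that Hw P[of j] in auto)
  next
    case (Vr j)
    show ?thesis unfolding Vr by (rule ext[OF Vu[of j]]) (use that Vr in auto)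
  next
    case (Vf j)
    show ?thesis unfolding Vf by (rule ext[OF Vl[of j]]) (use that Vf in auto)
  next
    case (Rn j)
    show ?thesis unfolding Rn by (rule ext[OF Ru[of j]]) (use that Rn Q[of j] in auto)
  next
    case (Rs j)
    show ?thesis unfolding Rs by (rule ext[OF Ru[of j]]) (use that Rs Q[of j] in auto)
  next
    case Cw
    show ?thesis unfolding Cw by (rule ext[OF Ht[of 0]]) auto
  next
    case Cx
    show ?thesis unfolding Cx by (rule ext[OF Ht[of "n + 1"]]) auto
  next
    case Cy
    have "reach Cx" by (rule ext[OF Ht[of "n + 1"]]) auto
    then show ?thesis unfolding Cy by (rule ext) auto
  qed (use that n Hu Ht Hd Vu Vl Ru in auto)
  moreover have "sym ?R" using E by (auto simp: sym_def)
  ultimately show ?thesis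
    unfolding graph_connected_def reach_def by (auto intro: rtrancl_trans dest: symD[OF sym_rtrancl])
qed

text \<open>The special vertices carry no pendants, since \<open>Q\<close> is confined to the levels
  from 3 to \<open>n - 1\<close>. This gives the bound 6 for all choices of the bits.\<close>

lemma glued_closed_nbhd:
  assumes n: "8 \<le> n" and P: "\<And>j. P j \<Longrightarrow> j < n" and Q: "\<And>j. Q j \<Longrightarrow> 3 \<le> j \<and> j < n"
  shows "closed_nbhd (glued_V n P Q) (glued_E n P Q) {Ru 2, Ru (n + 1)} =
    {Ru 2, Ru (n + 1), Ht 0, Cy, Ru 3, Ru n}"
proof -
  note E = glued_E_iff[OF n]
  have q: "\<not> Q 2" "\<not> Q (n + 1)" "\<not> Q (Suc n)" using Q by fastforce+
  have "inV n P Q v \<and> (link n (Ru 2) v \<or> link n (Ru (n + 1)) v) \<longleftrightarrow> v \<in> {Ht 0, Cy, Ru 3, Ru n}" for v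
    using n q by (cases v) (auto simp: inV_def link_def)
  moreover have "inV n P Q (Ru 2)" "inV n P Q (Ru (n + 1))" using n by (auto simp: inV_def)
  ultimately show ?thesis unfolding closed_nbhd_def E by auto
qed

lemma simple_graph_sides:
  assumes n: "8 \<le> n" and P: "\<And>j. P j \<Longrightarrow> j \<le> n"
  shows "simple_graph {v. inL n P v} (EL n P)" "simple_graph {v. inR n P v} (ER n P)"
proof -
  have f: "finite (glued_V n P P)" using glued_V_card(1) P by blast
  then have "finite {v. inL n P v}" "finite {v. inR n P v}"
    by (auto elim!: rev_finite_subset simp: inV_def)
  then show "simple_graph {v. inL n P v} (EL n P)" "simple_graph {v. inR n P v} (ER n P)"
    using link_irrefl by (auto simp: simple_graph_def EL_def ER_def link_def)
qed

lemma glued_simple_graph: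
  assumes n: "8 \<le> n" and P: "\<And>j. P j \<Longrightarrow> j \<le> n" "\<And>j. Q j \<Longrightarrow> j \<le> n"
  shows "simple_graph (glued_V n P Q) (glued_E n P Q)"
  using glued_V_card(1)[of P n Q, OF P] glue_E_iff[of n P Q] n link_irrefl
  by (auto simp: simple_graph_def inV_def link_def)

lemma link_triangle: "link n u v \<Longrightarrow> link n v w \<Longrightarrow> \<not> link n u w"
  using triangle[of n u v w] triangle[of n u w v] triangle[of n v u w] triangle[of n v w u]
    triangle[of n w u v] triangle[of n w v u]
  unfolding link_def by blast

text \<open>This holds whatever the bits are, so membership in the class is decided by drawability
  alone.\<close>

lemma glued_triangle_free:
  assumes "8 \<le> n"
  shows "triangle_free (glued_V n P Q) (glued_E n P Q)"
proof -
  have "glued_E n P Q u v \<Longrightarrow> link n u v" for u v using glue_E_iff[of n P Q u v] assms by simp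
  then show ?thesis using link_triangle unfolding triangle_free_def by blast
qed

lemma glued_drawable:
  assumes n: "8 \<le> n" and P: "\<And>j. P j \<Longrightarrow> 4 \<le> j \<and> j < n" and Q: "\<And>j. Q j \<Longrightarrow> 5 \<le> j \<and> j < n"
    and PP: "\<And>j. P j \<Longrightarrow> \<not> P (Suc j)" and PQ: "\<And>j k. P j \<Longrightarrow> Q k \<Longrightarrow> k \<noteq> j \<and> k \<noteq> Suc j"
  shows "unit_square_graph (glued_V n P Q) (glued_E n P Q)"
proof -
  define d :: real where "d = 1 / (400 * real (n + 2))"
  have d: "0 < d" "d * real (n + 2) \<le> 1 / 400" using n by (auto simp: d_def field_simps)
  interpret drawing n P Q d
    using n P Q PP PQ d by unfold_locales
  define p where "p v = (px h d n v, py h d n v)" for v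
  have dist: "linf_dist (p u) (p v) \<le> 1 \<longleftrightarrow> close u v" for u v
    by (auto simp: linf_dist_def p_def close_def)
  have linked: "close u v \<and> p u \<noteq> p v" if "inV n P Q u" "inV n P Q v" "link n u v" for u v
    using that arc_imp_close[of u v] arc_imp_close[of v u] by (auto simp: link_def p_def close_def)
  have "inj_on p (glued_V n P Q)"
  proof (rule inj_onI, rule ccontr)
    fix u v assume "u \<in> glued_V n P Q" "v \<in> glued_V n P Q" "p u = p v" "u \<noteq> v"
    then show False using linked[of u v] close_imp_link[of u v] by (simp add: p_def close_def)
  qed
  moreover have "glued_E n P Q u v \<longleftrightarrow> linf_dist (p u) (p v) \<le> 1"
    if "inV n P Q u" "inV n P Q v" "u \<noteq> v" for u v
    unfolding dist glued_E_iff[OF n] using that linked[OF that(1,2)] close_imp_link[OF that] by blast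
  ultimately show ?thesis unfolding unit_square_graph_def by blast
qed

section \<open>Normalising an arbitrary drawing\<close>

lemma near_flip:
  assumes "s = 1 \<or> s = - 1" "r = 1 \<or> r = - 1"
  shows "near (\<lambda>a. s * x a) (\<lambda>a. r * y a) u v \<longleftrightarrow> near x y u v"
  using assms by (auto simp: near_def)

text \<open>If \<open>t\<close> and \<open>d\<close> differ by more than 1 in one coordinate, then
  \<open>u\<close> and \<open>w\<close>, each within 1 of both, differ by less than 1 there and so
  by more than 1 in the other coordinate. Exchanging the axes makes the former coordinate vertical,
  and reflections fix the signs.\<close>

lemma orient:
  assumes "near x y t u" "near x y u d" "near x y d w" "near x y w t" "\<not> near x y t d" "\<not> near x y u w"
  obtains x' y' where "\<And>a b. near x' y' a b \<longleftrightarrow> near x y a b" "y' d + 1 < y' t" "x' w + 1 < x' u"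
proof -
  note result = that
  have sep: thesis if *: "\<And>a b. near x' y' a b \<longleftrightarrow> near x y a b"
    and y: "y' d + 1 < y' t \<or> y' t + 1 < y' d" for x' y'
  proof -
    have n: "near x' y' t u" "near x' y' u d" "near x' y' d w" "near x' y' w t" "\<not> near x' y' u w"
      unfolding * using assms by blast+
    have x: "x' w + 1 < x' u \<or> x' u + 1 < x' w"
      using y n unfolding near_def by linarith
    define s r :: real where "s = (if x' w + 1 < x' u then 1 else - 1)" and "r = (if y' d + 1 < y' t then 1 else - 1)"
    show thesis
    proof (rule result)
      show "near (\<lambda>a. s * x' a) (\<lambda>a. r * y' a) a b \<longleftrightarrow> near x y a b" for a b
        using near_flip[of s r x' y' a b] * by (simp add: s_def r_def)
      show "r * y' d + 1 < r * y' t" "s * x' w + 1 < s * x' u"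
        using x y by (auto simp: s_def r_def)
    qed
  qed
  show thesis
  proof (cases "y d + 1 < y t \<or> y t + 1 < y d")
    case True
    then show ?thesis by (intro sep[of x y]) auto
  next
    case False
    then have "x d + 1 < x t \<or> x t + 1 < x d" using assms(5) by (auto simp: near_def)
    then show ?thesis by (intro sep[of y x]) (auto simp: near_def)
  qed
qed

lemma glued_not_drawable:
  assumes n: "8 \<le> n" and "P j" "P (j + 2)" "Q (j + 1)" "Q (j + 2)" "Q (j + 3)" "4 \<le> j" "j + 4 \<le> n"
  shows "\<not> unit_square_graph (glued_V n P Q) (glued_E n P Q)"
proof
  assume "unit_square_graph (glued_V n P Q) (glued_E n P Q)"
  then obtain p where p: "\<And>u v. inV n P Q u \<Longrightarrow> inV n P Q v \<Longrightarrow> u \<noteq> v \<Longrightarrow>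
      glued_E n P Q u v \<longleftrightarrow> linf_dist (p u) (p v) \<le> 1"
    unfolding unit_square_graph_def by blast
  define x y where "x = fst \<circ> p" and "y = snd \<circ> p"
  have emb: "link n u v \<longleftrightarrow> near x y u v" if "inV n P Q u" "inV n P Q v" "u \<noteq> v" for u v
    using p[OF that] that glue_E_iff[of n P Q u v] n
    by (auto simp: inV_def linf_dist_def near_def x_def y_def)
  have "near x y (Ht 0) (Hu 0)" "near x y (Hu 0) (Hd 0)" "near x y (Hd 0) Cw" "near x y Cw (Ht 0)"
    "\<not> near x y (Ht 0) (Hd 0)" "\<not> near x y (Hu 0) Cw"
    by (simp_all add: emb[symmetric] inV_def link_def)
  then obtain x' y' where "\<And>a b. near x' y' a b \<longleftrightarrow> near x y a b"
    "y' (Hd 0) + 1 < y' (Ht 0)" "x' Cw + 1 < x' (Hu 0)"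
    by (rule orient) blast
  then interpret embedding n P Q x' y'
    using n emb by unfold_locales simp_all
  show False by (rule contradiction[of j]) (use assms in auto)
qed

text \<open>The bit \<open>i\<close> uses the levels \<open>4 * i\<close>, \<dots>, \<open>4 * i + 3\<close>: pendants of \<open>Ht\<close> at the two even ones,
  pendants of \<open>Ru\<close> at the last three.\<close>
definition tbits :: "nat set \<Rightarrow> nat \<Rightarrow> bool" where
  "tbits A j \<longleftrightarrow> even j \<and> j div 4 \<in> A"

definition rbits :: "nat set \<Rightarrow> nat \<Rightarrow> bool" where
  "rbits B j \<longleftrightarrow> j mod 4 \<noteq> 0 \<and> j div 4 \<in> B"

lemma tbits_bounds:
  assumes "A \<subseteq> {1..N}" "tbits A j"
  shows "4 \<le> j" "j < 4 * N + 4" "\<not> tbits A (Suc j)"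
proof -
  have "1 \<le> j div 4" "j div 4 \<le> N" using assms by (auto simp: tbits_def)
  then show "4 \<le> j" "j < 4 * N + 4" by linarith+
  show "\<not> tbits A (Suc j)" using assms(2) by (simp add: tbits_def)
qed

lemma rbits_bounds:
  assumes "B \<subseteq> {1..N}" "rbits B j"
  shows "5 \<le> j" "j < 4 * N + 4"
proof -
  have "1 \<le> j div 4" "j div 4 \<le> N" "j mod 4 \<noteq> 0" using assms by (auto simp: rbits_def)
  then show "5 \<le> j" "j < 4 * N + 4" by presburger+
qed

text \<open>As \<open>j\<close> is even, \<open>j\<close> and \<open>Suc j\<close> lie in the same
  block of four; a collision would put the number of that block into both sets.\<close>

lemma bits_apart:
  assumes "A \<inter> B = {}" "tbits A j" "rbits B k"
  shows "k \<noteq> j" "k \<noteq> Suc j"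
proof -
  have "even j" using assms by (simp add: tbits_def)
  then have "Suc j div 4 = j div 4" by presburger
  then show "k \<noteq> j" "k \<noteq> Suc j" using assms by (auto simp: tbits_def rbits_def)
qed

lemma glued_iff_disjoint:
  assumes A: "A \<subseteq> {1..N}" and B: "B \<subseteq> {1..N}" and N: "0 < N" and n: "n = 4 * N + 4"
  shows "triangle_free_unit_square (glued_V n (tbits A) (rbits B)) (glued_E n (tbits A) (rbits B)) \<longleftrightarrow> A \<inter> B = {}"
proof -
  note bA = tbits_bounds[OF A] and bB = rbits_bounds[OF B]
  have n8: "8 \<le> n" using N n by simp
  have le: "tbits A j \<Longrightarrow> j \<le> n" "rbits B j \<Longrightarrow> j \<le> n" for j using bA(2)[of j] bB(2)[of j] n by auto
  have "unit_square_graph (glued_V n (tbits A) (rbits B)) (glued_E n (tbits A) (rbits B)) \<longleftrightarrow> A \<inter> B = {}"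
  proof (intro iffI)
    assume "A \<inter> B = {}"
    then show "unit_square_graph (glued_V n (tbits A) (rbits B)) (glued_E n (tbits A) (rbits B))"
      using n8 n bA bB bits_apart[of A B] by (intro glued_drawable) auto
  next
    assume *: "unit_square_graph (glued_V n (tbits A) (rbits B)) (glued_E n (tbits A) (rbits B))"
    show "A \<inter> B = {}"
    proof (rule ccontr)
      assume "A \<inter> B \<noteq> {}"
      then obtain i where i: "i \<in> A" "i \<in> B" by blast
      have d: "(4 * i + 1) div 4 = i" "(4 * i + 2) div 4 = i" "(4 * i + 3) div 4 = i"
        "(4 * i + 1) mod 4 = 1" "(4 * i + 2) mod 4 = 2" "(4 * i + 3) mod 4 = 3" by presburger+
      have "1 \<le> i" "i \<le> N" using i A by auto
      then have "\<not> unit_square_graph (glued_V n (tbits A) (rbits B)) (glued_E n (tbits A) (rbits B))"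
        using i n d by (intro glued_not_drawable[OF n8, of _ "4 * i"]) (simp_all add: tbits_def rbits_def)
      with * show False by contradiction
    qed
  qed
  then show ?thesis
    unfolding triangle_free_unit_square_def
    using glued_simple_graph[OF n8 le] glued_triangle_free[OF n8] by blast
qed

theorem theorem6p5:
  shows "disjointness_expressing (triangle_free_unit_square :: nat set \<Rightarrow> (nat \<Rightarrow> nat \<Rightarrow> bool) \<Rightarrow> bool) 6 1"
proof -
  let ?c = "to_nat :: vtx \<Rightarrow> nat"
  have c: "inj ?c" by simp
  show ?thesis unfolding disjointness_expressing_def Let_def
  proof (intro exI[of _ 200] conjI allI impI)
    fix N :: nat assume N: "0 < N"
    \<comment> \<open>The last bit \<open>N\<close> has base level \<open>4 * N\<close> and uses
      boxes up to \<open>4 * N + 4\<close>.\<close>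
    define n where "n = 4 * N + 4"
    define S where "S = {Ru 2, Ru (n + 1)}"
    define L R where "L X = {v. inL n (tbits X) v}" and "R X = {v. inR n (rbits X) v}" for X
    define K where "K = {Ru 2, Ru (n + 1), Ht 0, Cy, Ru 3, Ru n}"
    have n8: "8 \<le> n" using N n_def by simp
    have le: "tbits A j \<Longrightarrow> j < n" "rbits A j \<Longrightarrow> 3 \<le> j \<and> j < n" if "A \<subseteq> {1..N}" for A j
      using tbits_bounds[OF that, of j] rbits_bounds[OF that, of j] by (auto simp: n_def)
    have le': "tbits A j \<Longrightarrow> j \<le> n" "rbits A j \<Longrightarrow> 2 \<le> j \<and> j \<le> n" if "A \<subseteq> {1..N}" for A j
      using le[OF that, of j] by auto
    have gV: "glue_V (?c ` L A) (?c ` R B) = ?c ` glued_V n (tbits A) (rbits B)" for A B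
      unfolding glue_V_map[OF c] by (auto simp: glue_V_def L_def R_def inV_def)
    have gE: "glue_E (map_E ?c (EL n (tbits A))) (map_E ?c (ER n (rbits B))) = map_E ?c (glued_E n (tbits A) (rbits B))" for A B
      by (rule glue_E_map[OF c])
    have nb: "closed_nbhd (glued_V n (tbits A) (rbits B)) (glued_E n (tbits A) (rbits B)) S = K"
      if "A \<subseteq> {1..N}" "B \<subseteq> {1..N}" for A B
      unfolding S_def K_def using le[OF that(1)] le[OF that(2)] by (intro glued_closed_nbhd n8) auto
    have sides: "simple_graph (?c ` L X) (map_E ?c (EL n (tbits X))) \<and> simple_graph (?c ` R X) (map_E ?c (ER n (rbits X)))
        \<and> ?c ` S \<subseteq> ?c ` L X \<and> ?c ` S \<subseteq> ?c ` R X" if X: "X \<subseteq> {1..N}" for X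
    proof -
      have "simple_graph (L X) (EL n (tbits X))" "simple_graph (R X) (ER n (rbits X))"
        unfolding L_def R_def using le[OF X] n8 by (auto intro!: simple_graph_sides less_imp_le)
      moreover have "S \<subseteq> L X" "S \<subseteq> R X" using n8 by (auto simp: S_def L_def R_def)
      ultimately show ?thesis by (simp add: simple_graph_map[OF c] image_mono)
    qed
    have card: "real (card (?c ` glued_V n (tbits A) (rbits B))) \<le> 200 * real N powr (1 / 1)"
      if "A \<subseteq> {1..N}" "B \<subseteq> {1..N}" for A B
    proof -
      have "card (?c ` glued_V n (tbits A) (rbits B)) \<le> card (glued_V n (tbits A) (rbits B))"
        using le[OF that(1)] le[OF that(2)] by (intro card_image_le glued_V_card(1)) (auto intro: less_imp_le)
      also have "\<dots> \<le> 13 * (n + 3) + 3"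
        using le[OF that(1)] le[OF that(2)] by (intro glued_V_card(2)) (auto intro: less_imp_le)
      \<comment> \<open>The left side is \<open>52 * N + 94\<close>, at most \<open>146 * N\<close>
        for positive \<open>N\<close>.\<close>
      also have "\<dots> \<le> 200 * N" using N by (simp add: n_def)
      finally show ?thesis by simp
    qed
    have glued: "?c ` L A \<inter> ?c ` R B = ?c ` S
        \<and> graph_connected (?c ` glued_V n (tbits A) (rbits B)) (map_E ?c (glued_E n (tbits A) (rbits B)))
        \<and> card (?c ` K) \<le> 6
        \<and> (triangle_free_unit_square (?c ` glued_V n (tbits A) (rbits B)) (map_E ?c (glued_E n (tbits A) (rbits B))) \<longleftrightarrow> A \<inter> B = {})"
      if AB: "A \<subseteq> {1..N}" "B \<subseteq> {1..N}" for A B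
    proof (intro conjI)
      have "L A \<inter> R B = S"
      proof (rule set_eqI)
        show "v \<in> L A \<inter> R B \<longleftrightarrow> v \<in> S" for v
          using n8 by (cases v) (auto simp: L_def R_def S_def)
      qed
      then show "?c ` L A \<inter> ?c ` R B = ?c ` S" by (simp add: image_Int[OF c, symmetric])
      show "graph_connected (?c ` glued_V n (tbits A) (rbits B)) (map_E ?c (glued_E n (tbits A) (rbits B)))"
        using le'[OF AB(1)] le'[OF AB(2)] by (intro graph_connected_map[OF c] glued_connected n8)
      have "card (?c ` set [Ru 2, Ru (n + 1), Ht 0, Cy, Ru 3, Ru n]) \<le> length [Ru 2, Ru (n + 1), Ht 0, Cy, Ru 3, Ru n]"
        by (rule le_trans[OF card_image_le card_length]) simp
      then show "card (?c ` K) \<le> 6" by (simp add: K_def)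
      show "triangle_free_unit_square (?c ` glued_V n (tbits A) (rbits B)) (map_E ?c (glued_E n (tbits A) (rbits B))) \<longleftrightarrow> A \<inter> B = {}"
        unfolding triangle_free_unit_square_map[OF c] by (rule glued_iff_disjoint[OF AB N n_def])
    qed
    have iso: "\<exists>f. bij_betw f (?c ` K) (?c ` K) \<and> (\<forall>x\<in>?c ` S. f x = x) \<and>
        (\<forall>u\<in>?c ` K. \<forall>v\<in>?c ` K. map_E ?c (glued_E n (tbits A) (rbits B)) u v \<longleftrightarrow> map_E ?c (glued_E n (tbits A') (rbits B')) (f u) (f v))"
      for A B A' B'
    \<comment> \<open>The identity serves as isomorphism: \<open>K\<close> is the same set in every
      glued graph, and adjacency inside it is \<open>link\<close>, which does not depend on the
      bits.\<close>
    proof (intro exI[of _ id] conjI ballI)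
      fix u v assume "u \<in> ?c ` K" "v \<in> ?c ` K"
      moreover have "inL n (tbits X) u \<or> inR n (rbits Y) u" if "u \<in> K" for u X Y
        using that n8 by (auto simp: K_def)
      ultimately show "map_E ?c (glued_E n (tbits A) (rbits B)) u v \<longleftrightarrow> map_E ?c (glued_E n (tbits A') (rbits B')) (id u) (id v)"
        using n8 by (auto simp: map_E_image[OF c] glue_E_iff)
    qed auto
    show "\<exists>(S :: nat set) (VL :: nat set \<Rightarrow> nat set) EL (VR :: nat set \<Rightarrow> nat set) ER.
         (\<forall>X \<subseteq> {1..N}. simple_graph (VL X) (EL X) \<and> simple_graph (VR X) (ER X)
              \<and> S \<subseteq> VL X \<and> S \<subseteq> VR X) \<and>
         (\<forall>A \<subseteq> {1..N}. \<forall>B \<subseteq> {1..N}.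
              VL A \<inter> VR B = S
            \<and> graph_connected (glue_V (VL A) (VR B)) (glue_E (EL A) (ER B))
            \<and> real (card (glue_V (VL A) (VR B))) \<le> 200 * real N powr (1 / 1)
            \<and> card (closed_nbhd (glue_V (VL A) (VR B)) (glue_E (EL A) (ER B)) S) \<le> 6
            \<and> (triangle_free_unit_square (glue_V (VL A) (VR B)) (glue_E (EL A) (ER B)) \<longleftrightarrow> A \<inter> B = {})) \<and>
         (\<forall>A \<subseteq> {1..N}. \<forall>B \<subseteq> {1..N}. \<forall>A' \<subseteq> {1..N}. \<forall>B' \<subseteq> {1..N}.
            (\<exists>f. bij_betw f (closed_nbhd (glue_V (VL A) (VR B)) (glue_E (EL A) (ER B)) S)
                  (closed_nbhd (glue_V (VL A') (VR B')) (glue_E (EL A') (ER B')) S) \<and> (\<forall>x\<in>S. f x = x) \<and>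
               (\<forall>u\<in>closed_nbhd (glue_V (VL A) (VR B)) (glue_E (EL A) (ER B)) S.
                \<forall>v\<in>closed_nbhd (glue_V (VL A) (VR B)) (glue_E (EL A) (ER B)) S.
                  glue_E (EL A) (ER B) u v \<longleftrightarrow> glue_E (EL A') (ER B') (f u) (f v))))"
      by (rule exI[of _ "?c ` S"], rule exI[of _ "\<lambda>X. ?c ` L X"], rule exI[of _ "\<lambda>X. map_E ?c (EL n (tbits X))"],
          rule exI[of _ "\<lambda>X. ?c ` R X"], rule exI[of _ "\<lambda>X. map_E ?c (ER n (rbits X))"])
        (simp only: gV gE closed_nbhd_map[OF c] nb sides card glued iso simp_thms cong: imp_cong)
  qed simp
qed

end
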